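(* For $i=1,2$, let $G_i$ be an essentially principal étale groupoid whose unit space is a Cantor set. Suppose that $G_i$ is minimal. For each $i=1,2$, let $\Gamma_i$ be a subgroup of $[[G_i]]$ such that $D([[G_i]])\subset\Gamma_i$. If $\Gamma_1$ and $\Gamma_2$ are isomorphic as discrete groups, then $G_1$ and $G_2$ are isomorphic as étale groupoids.
   Context: A Cantor set is a (non-empty) compact, metrizable, totally disconnected space with no isolated points. An étale groupoid is a second countable locally compact Hausdorff topological groupoid $G$ whose range map is a local homeomorphism; an isomorphism of étale groupoids is a groupoid isomorphism that is a homeomorphism. $G^{(0)}$ is the unit space, $s,r$ are the source and range maps, and $gh$ is defined when $s(g)=r(h)$. The $G$-orbit of $x\in G^{(0)}$ is $\{r(g)\mid g\in G,\ s(g)=x\}$; $G$ is minimal if every $G$-orbit is dense in $G^{(0)}$. $G$ is essentially principal if the interior of $\{g\in G\mid r(g)=s(g)\}$ is $G^{(0)}$. A $G$-set is a subset $U\subset G$ such that $r|U$ and $s|U$ are injective; for an open $G$-set $U$, $\pi_U=r\circ(s|U)^{-1}:s(U)\to r(U)$ (a homeomorphism). When $G^{(0)}$ is compact, the topological full group $[[G]]$ is the group of all $\alpha\in\mathrm{Homeo}(G^{(0)})$ for which there is a compact open $G$-set $U$ with $\alpha=\pi_U$ (so $s(U)=r(U)=G^{(0)}$). $D(\Gamma)$ denotes the commutator subgroup of a group $\Gamma$. *)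

theory Defs
  imports "HOL-Analysis.Analysis" "HOL-Algebra.Bij" "HOL-Algebra.Generated_Groups"
begin

section \<open>Topological notions\<close>

definition totally_disconnected_space :: "'a topology \<Rightarrow> bool" where
  "totally_disconnected_space X \<longleftrightarrow> (\<forall>S. connectedin X S \<longrightarrow> S = {} \<or> (\<exists>x. S = {x}))"

definition cantor_set :: "'a topology \<Rightarrow> bool" where
  "cantor_set X \<longleftrightarrow>
     topspace X \<noteq> {} \<and> compact_space X \<and> metrizable_space X \<and>
     totally_disconnected_space X \<and> (\<forall>x\<in>topspace X. \<not> openin X {x})"

definition local_homeomorphism :: "'a topology \<Rightarrow> 'b topology \<Rightarrow> ('a \<Rightarrow> 'b) \<Rightarrow> bool" where
  "local_homeomorphism X Y f \<longleftrightarrow>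
     (\<forall>x\<in>topspace X. \<exists>U. openin X U \<and> x \<in> U \<and> openin Y (f ` U) \<and>
        homeomorphic_map (subtopology X U) (subtopology Y (f ` U)) f)"

text \<open>Elements are extensional on \<open>topspace X\<close> (as in \<^const>\<open>BijGroup\<close>), so that
  equality in the group is equality of maps on the space.\<close>

definition homeo_group :: "'a topology \<Rightarrow> ('a \<Rightarrow> 'a) monoid" where
  "homeo_group X =
     (BijGroup (topspace X))\<lparr>carrier := {f \<in> Bij (topspace X). homeomorphic_map X X f}\<rparr>"


section \<open>Topological groupoids\<close>

text \<open>A groupoid is given by its arrows (the points of \<open>gtop G\<close>), units being particular arrows.
  The product \<open>gmult\<close> is total as an HOL function, but it is only meaningful, and only
  constrained, on composable pairs of arrows.\<close>

record 'a top_groupoid =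
  gtop :: "'a topology"
  src :: "'a \<Rightarrow> 'a"
  rng :: "'a \<Rightarrow> 'a"
  gmult :: "'a \<Rightarrow> 'a \<Rightarrow> 'a"
  ginv :: "'a \<Rightarrow> 'a"

definition arrows :: "('a, 'm) top_groupoid_scheme \<Rightarrow> 'a set" where
  "arrows G = topspace (gtop G)"

definition unit_space :: "('a, 'm) top_groupoid_scheme \<Rightarrow> 'a set" where
  "unit_space G = rng G ` arrows G"

definition unit_top :: "('a, 'm) top_groupoid_scheme \<Rightarrow> 'a topology" where
  "unit_top G = subtopology (gtop G) (unit_space G)"

definition composable :: "('a, 'm) top_groupoid_scheme \<Rightarrow> ('a \<times> 'a) set" where
  "composable G = {(g, h). g \<in> arrows G \<and> h \<in> arrows G \<and> src G g = rng G h}"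

locale groupoid =
  fixes G :: "('a, 'm) top_groupoid_scheme"
  assumes src_closed: "g \<in> arrows G \<Longrightarrow> src G g \<in> arrows G"
    and rng_closed: "g \<in> arrows G \<Longrightarrow> rng G g \<in> arrows G"
    and src_src: "g \<in> arrows G \<Longrightarrow> src G (src G g) = src G g"
    and rng_src: "g \<in> arrows G \<Longrightarrow> rng G (src G g) = src G g"
    and src_rng: "g \<in> arrows G \<Longrightarrow> src G (rng G g) = rng G g"
    and rng_rng: "g \<in> arrows G \<Longrightarrow> rng G (rng G g) = rng G g"
    and mult_closed: "(g, h) \<in> composable G \<Longrightarrow> gmult G g h \<in> arrows G"
    and src_mult: "(g, h) \<in> composable G \<Longrightarrow> src G (gmult G g h) = src G h"
    and rng_mult: "(g, h) \<in> composable G \<Longrightarrow> rng G (gmult G g h) = rng G g"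
    and mult_assoc: "\<lbrakk>(g, h) \<in> composable G; (h, k) \<in> composable G\<rbrakk>
      \<Longrightarrow> gmult G (gmult G g h) k = gmult G g (gmult G h k)"
    and mult_src: "g \<in> arrows G \<Longrightarrow> gmult G g (src G g) = g"
    and rng_mult_self: "g \<in> arrows G \<Longrightarrow> gmult G (rng G g) g = g"
    and inv_closed: "g \<in> arrows G \<Longrightarrow> ginv G g \<in> arrows G"
    and src_inv: "g \<in> arrows G \<Longrightarrow> src G (ginv G g) = rng G g"
    and rng_inv: "g \<in> arrows G \<Longrightarrow> rng G (ginv G g) = src G g"
    and inv_mult: "g \<in> arrows G \<Longrightarrow> gmult G (ginv G g) g = src G g"
    and mult_inv: "g \<in> arrows G \<Longrightarrow> gmult G g (ginv G g) = rng G g"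

text \<open>Continuity of \<open>rng\<close> and \<open>src\<close> follows, since \<open>rng g = g g\<inverse>\<close> and \<open>src g = g\<inverse> g\<close>.\<close>

locale topological_groupoid = groupoid +
  assumes continuous_mult:
      "continuous_map (subtopology (prod_topology (gtop G) (gtop G)) (composable G)) (gtop G)
         (\<lambda>(g, h). gmult G g h)"
    and continuous_inv: "continuous_map (gtop G) (gtop G) (ginv G)"

locale etale_groupoid = topological_groupoid +
  assumes second_countable: "second_countable (gtop G)"
    and locally_compact: "locally_compact_space (gtop G)"
    and Hausdorff: "Hausdorff_space (gtop G)"
    and local_homeo_rng: "local_homeomorphism (gtop G) (unit_top G) (rng G)"

definition groupoid_hom ::
    "('a, 'm) top_groupoid_scheme \<Rightarrow> ('b, 'n) top_groupoid_scheme \<Rightarrow> ('a \<Rightarrow> 'b) \<Rightarrow> bool" where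
  "groupoid_hom G H \<phi> \<longleftrightarrow>
     \<phi> \<in> arrows G \<rightarrow> arrows H \<and>
     (\<forall>g\<in>arrows G. \<phi> (src G g) = src H (\<phi> g) \<and> \<phi> (rng G g) = rng H (\<phi> g)) \<and>
     (\<forall>(g, h)\<in>composable G. \<phi> (gmult G g h) = gmult H (\<phi> g) (\<phi> h))"

definition etale_groupoid_iso ::
    "('a, 'm) top_groupoid_scheme \<Rightarrow> ('b, 'n) top_groupoid_scheme \<Rightarrow> bool" where
  "etale_groupoid_iso G H \<longleftrightarrow>
     (\<exists>\<phi>. bij_betw \<phi> (arrows G) (arrows H) \<and> groupoid_hom G H \<phi> \<and>
          homeomorphic_map (gtop G) (gtop H) \<phi>)"

definition orbit_of :: "('a, 'm) top_groupoid_scheme \<Rightarrow> 'a \<Rightarrow> 'a set" where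
  "orbit_of G x = {rng G g | g. g \<in> arrows G \<and> src G g = x}"

definition minimal_groupoid :: "('a, 'm) top_groupoid_scheme \<Rightarrow> bool" where
  "minimal_groupoid G \<longleftrightarrow>
     (\<forall>x\<in>unit_space G. unit_top G closure_of orbit_of G x = unit_space G)"

definition essentially_principal :: "('a, 'm) top_groupoid_scheme \<Rightarrow> bool" where
  "essentially_principal G \<longleftrightarrow>
     gtop G interior_of {g \<in> arrows G. rng G g = src G g} = unit_space G"


section \<open>The topological full group\<close>

definition G_set :: "('a, 'm) top_groupoid_scheme \<Rightarrow> 'a set \<Rightarrow> bool" where
  "G_set G U \<longleftrightarrow> U \<subseteq> arrows G \<and> inj_on (rng G) U \<and> inj_on (src G) U"

definition G_set_map :: "('a, 'm) top_groupoid_scheme \<Rightarrow> 'a set \<Rightarrow> 'a \<Rightarrow> 'a" where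
  "G_set_map G U = restrict (rng G \<circ> inv_into U (src G)) (src G ` U)"

text \<open>The conditions on \<open>src G ` U\<close> and \<open>rng G ` U\<close> say that domain and codomain of
  \<open>G_set_map G U\<close> are those of \<open>\<alpha>\<close>, which equality of HOL functions alone does not express.\<close>

definition topological_full_group ::
    "('a, 'm) top_groupoid_scheme \<Rightarrow> ('a \<Rightarrow> 'a) monoid" where
  "topological_full_group G =
     (homeo_group (unit_top G))
       \<lparr>carrier := {\<alpha> \<in> carrier (homeo_group (unit_top G)).
          \<exists>U. G_set G U \<and> compactin (gtop G) U \<and> openin (gtop G) U \<and>
              src G ` U = unit_space G \<and> rng G ` U = unit_space G \<and> \<alpha> = G_set_map G U}\<rparr>"

definition commutator_subgroup :: "('g, 'm) monoid_scheme \<Rightarrow> 'g set" where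
  "commutator_subgroup \<Gamma> = derived \<Gamma> (carrier \<Gamma>)"

end

theory Submission
  imports Defs
begin

text \<open>Because of minimality and the absence of isolated points, the commutator subgroup already
  contains, for any \<open>x\<close> in any open set \<open>V\<close>, an element supported in \<open>V\<close> that permutes five points
  of the orbit of \<open>x\<close> cyclically. This makes Rubin's reconstruction method (in the short form due
  to Belk, Elliott and Matucci) work: inclusion of supports can be read off from the abstract
  group, because \<open>f\<close> and \<open>g\<close> having disjoint supports is approximated by a first-order condition on
  commutators. Supports are clopen by essential principality, they form a base, and points are
  recovered from them by compactness, so that an isomorphism of the groups is implemented by a
  homeomorphism of the unit spaces. Finally, by essential principality, an arrow \<open>g\<close> is the same
  thing as the germ at \<open>src g\<close> of a group element, so the homeomorphism extends to arrows.\<close>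

section \<open>Reading off supports from the abstract group\<close>

text \<open>Commuting elements need not have disjoint supports, so disjointness has to be tested by
  a subtler relation, and \<open>alg_disjoint\<close> is only trapped between two geometric
  statements: it holds when \<open>f\<close> and \<open>g\<close> move disjoint sets, and it implies
  that \<open>f\<close> and the twelfth power of \<open>g\<close> move disjoint sets. The gap is
  harmless as long as every point of every open set can be moved by the twelfth power of an element
  supported there. This dictates the five points: a three-cycle, which is what a commutator of two
  overlapping transpositions gives, has trivial twelfth power, while 12 is 2 modulo 5. The other
  constraint is that \<Gamma> is only known to contain the commutators of the full group.
  Transpositions along an arrow exist in the full group but may lie outside \<Gamma>, so elements of
  \<Gamma> with a wanted behaviour are built as commutators of transpositions. A transposition can
  only realise an arrow whose source and range differ; an isotropy arrow is reached by factoring it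
  through a further point of the orbit.\<close>

definition moved :: "'a topology \<Rightarrow> ('a \<Rightarrow> 'a) \<Rightarrow> 'a set" where
  "moved X f = {x \<in> topspace X. f x \<noteq> x}"

definition support :: "'a topology \<Rightarrow> ('a \<Rightarrow> 'a) \<Rightarrow> 'a set" where
  "support X f = X closure_of moved X f"

definition commutator :: "('g, 'm) monoid_scheme \<Rightarrow> 'g \<Rightarrow> 'g \<Rightarrow> 'g" where
  "commutator H a b = a \<otimes>\<^bsub>H\<^esub> b \<otimes>\<^bsub>H\<^esub> inv\<^bsub>H\<^esub> a \<otimes>\<^bsub>H\<^esub> inv\<^bsub>H\<^esub> b"

text \<open>Elements with disjoint supports satisfy the following relation; conversely it forces the
  supports of \<open>f\<close> and \<open>g\<^sup>1\<^sup>2\<close> to be disjoint. The exponent is the least common multiple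
  of 1, 2, 3, 4, so that a point moved by \<open>g\<^sup>1\<^sup>2\<close> has at least five points in its \<open>g\<close>-orbit.\<close>

definition alg_disjoint :: "('g, 'm) monoid_scheme \<Rightarrow> 'g \<Rightarrow> 'g \<Rightarrow> bool" where
  "alg_disjoint H f g \<longleftrightarrow>
     (\<forall>h\<in>carrier H. f \<otimes>\<^bsub>H\<^esub> h \<noteq> h \<otimes>\<^bsub>H\<^esub> f \<longrightarrow>
        (\<exists>a\<in>carrier H. \<exists>b\<in>carrier H. a \<otimes>\<^bsub>H\<^esub> g = g \<otimes>\<^bsub>H\<^esub> a \<and> b \<otimes>\<^bsub>H\<^esub> g = g \<otimes>\<^bsub>H\<^esub> b \<and>
           commutator H a (commutator H b h) \<noteq> \<one>\<^bsub>H\<^esub> \<and>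
           commutator H a (commutator H b h) \<otimes>\<^bsub>H\<^esub> g = g \<otimes>\<^bsub>H\<^esub> commutator H a (commutator H b h)))"

text \<open>A centralizer condition. The twelfth powers of elements that pass for disjoint from
  \<open>f\<close> live off the support of \<open>f\<close>, yet between them move every point
  there; commuting with all of them confines \<open>k\<close> to the support of
  \<open>f\<close>.\<close>

definition alg_subsupport :: "('g, 'm) monoid_scheme \<Rightarrow> 'g \<Rightarrow> 'g \<Rightarrow> bool" where
  "alg_subsupport H k f \<longleftrightarrow>
     (\<forall>g\<in>carrier H. alg_disjoint H f g \<longrightarrow>
        k \<otimes>\<^bsub>H\<^esub> (g [^]\<^bsub>H\<^esub> (12::nat)) = (g [^]\<^bsub>H\<^esub> (12::nat)) \<otimes>\<^bsub>H\<^esub> k)"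

section \<open>Invariance of the relations under group isomorphism\<close>

lemma (in group) commutator_closed:
  "a \<in> carrier G \<Longrightarrow> b \<in> carrier G \<Longrightarrow> commutator G a b \<in> carrier G"
  by (simp add: commutator_def)

lemma (in group_hom) hom_commutator:
  "a \<in> carrier G \<Longrightarrow> b \<in> carrier G \<Longrightarrow> h (commutator G a b) = commutator H (h a) (h b)"
  by (simp add: commutator_def)

text \<open>The relation involves only group operations and quantifiers over the carrier; writing
  \<open>carrier K\<close> as the image of \<open>carrier H\<close> turns the latter into
  quantifiers over \<open>carrier H\<close>.\<close>

lemma iso_alg_disjoint:
  assumes "group H" "group K" and iso: "\<Phi> \<in> iso H K"
    and f: "f \<in> carrier H" and g: "g \<in> carrier H"
  shows "alg_disjoint K (\<Phi> f) (\<Phi> g) \<longleftrightarrow> alg_disjoint H f g"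
proof -
  interpret H: group H by fact
  interpret K: group K by fact
  interpret group_hom H K \<Phi>
    using iso by unfold_locales (simp add: iso_def)
  have carr: "carrier K = \<Phi> ` carrier H" and inj: "inj_on \<Phi> (carrier H)"
    using iso by (auto simp: iso_def bij_betw_def)
  have eq: "\<Phi> a = \<Phi> b \<longleftrightarrow> a = b" if "a \<in> carrier H" "b \<in> carrier H" for a b
    using that inj by (auto simp: inj_on_def)
  have eqm: "\<Phi> a \<otimes>\<^bsub>K\<^esub> \<Phi> b = \<Phi> b \<otimes>\<^bsub>K\<^esub> \<Phi> a \<longleftrightarrow> a \<otimes>\<^bsub>H\<^esub> b = b \<otimes>\<^bsub>H\<^esub> a"
    if "a \<in> carrier H" "b \<in> carrier H" for a b
    using that eq[of "a \<otimes>\<^bsub>H\<^esub> b" "b \<otimes>\<^bsub>H\<^esub> a"] by simp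
  have eq1: "\<Phi> a = \<one>\<^bsub>K\<^esub> \<longleftrightarrow> a = \<one>\<^bsub>H\<^esub>" if "a \<in> carrier H" for a
    using that eq[of a "\<one>\<^bsub>H\<^esub>"] by simp
  show ?thesis
    unfolding alg_disjoint_def carr ball_simps bex_simps
    using f g by (simp add: eqm eq1 hom_commutator[symmetric] H.commutator_closed cong: conj_cong)
qed

lemma iso_alg_subsupport:
  assumes "group H" "group K" and iso: "\<Phi> \<in> iso H K"
    and f: "f \<in> carrier H" and k: "k \<in> carrier H"
  shows "alg_subsupport K (\<Phi> k) (\<Phi> f) \<longleftrightarrow> alg_subsupport H k f"
proof -
  interpret H: group H by fact
  interpret K: group K by fact
  interpret group_hom H K \<Phi>
    using iso by unfold_locales (simp add: iso_def)
  have carr: "carrier K = \<Phi> ` carrier H" and inj: "inj_on \<Phi> (carrier H)"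
    using iso by (auto simp: iso_def bij_betw_def)
  have eqm: "\<Phi> a \<otimes>\<^bsub>K\<^esub> \<Phi> b = \<Phi> b \<otimes>\<^bsub>K\<^esub> \<Phi> a \<longleftrightarrow> a \<otimes>\<^bsub>H\<^esub> b = b \<otimes>\<^bsub>H\<^esub> a"
    if "a \<in> carrier H" "b \<in> carrier H" for a b
    using that inj by (metis H.m_closed hom_mult inj_onD)
  show ?thesis
    unfolding alg_subsupport_def carr ball_simps
    using f k by (simp add: eqm hom_nat_pow[symmetric] iso_alg_disjoint[OF assms(1,2,3)])
qed

text \<open>Collects what the reconstruction of the space uses about \<Gamma>. The powers in
  \<open>moves\<close> are iterates of a map, which can be computed pointwise;
  \<open>act_pow\<close> identifies them with powers in the group. Since supports are closures,
  \<open>open_support\<close> makes them clopen.\<close>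

locale rubin_action = group H for H :: "('a \<Rightarrow> 'a) monoid" (structure) +
  fixes X :: "'a topology"
  assumes Hausdorff: "Hausdorff_space X"
    and compact: "compact_space X"
    and homeo: "f \<in> carrier H \<Longrightarrow> homeomorphic_map X X f"
    and act_mult: "\<lbrakk>f \<in> carrier H; g \<in> carrier H; x \<in> topspace X\<rbrakk> \<Longrightarrow> (f \<otimes> g) x = f (g x)"
    and act_one: "x \<in> topspace X \<Longrightarrow> \<one> x = x"
    and faithful: "\<lbrakk>f \<in> carrier H; \<And>x. x \<in> topspace X \<Longrightarrow> f x = x\<rbrakk> \<Longrightarrow> f = \<one>"
    and moves: "\<lbrakk>openin X V; x \<in> V\<rbrakk> \<Longrightarrow>
      \<exists>g\<in>carrier H. support X g \<subseteq> V \<and> (g ^^ 12) x \<noteq> x"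
    and open_support: "f \<in> carrier H \<Longrightarrow> openin X (support X f)"
begin

section \<open>Elementary facts about moved sets and supports\<close>

lemma act_closed: "f \<in> carrier H \<Longrightarrow> x \<in> topspace X \<Longrightarrow> f x \<in> topspace X"
  using homeo homeomorphic_imp_surjective_map by fastforce

lemma act_inj: "\<lbrakk>f \<in> carrier H; x \<in> topspace X; y \<in> topspace X; f x = f y\<rbrakk> \<Longrightarrow> x = y"
  using homeo homeomorphic_imp_injective_map by (fastforce dest: inj_onD)

lemma act_inv [simp]:
  assumes "f \<in> carrier H" "x \<in> topspace X"
  shows "(inv f) (f x) = x" "f ((inv f) x) = x"
  using assms act_mult[of "inv f" f x] act_mult[of f "inv f" x] act_one by auto

lemma act_eqI:
  assumes f: "f \<in> carrier H" and g: "g \<in> carrier H" and eq: "\<And>x. x \<in> topspace X \<Longrightarrow> f x = g x"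
  shows "f = g"
proof -
  have "inv g \<otimes> f = \<one>"
    using f g by (intro faithful) (auto simp: act_mult eq)
  then show ?thesis
    using f g by (metis inv_equality inv_inv inv_closed)
qed

lemma act_pow:
  assumes "g \<in> carrier H" "x \<in> topspace X"
  shows "(g [^] (n::nat)) x = (g ^^ n) x"
  using assms(2)
proof (induction n arbitrary: x)
  case (Suc n)
  then show ?case
    using assms(1) by (simp add: act_mult act_closed funpow_swap1)
qed (simp add: act_one)

lemma openin_moved: assumes "f \<in> carrier H" shows "openin X (moved X f)"
proof -
  have "closedin X {x \<in> topspace X. f x = id x}"
    using homeo[OF assms] by (intro closedin_continuous_maps_eq[OF Hausdorff])
      (auto simp: homeomorphic_imp_continuous_map)
  moreover have "moved X f = topspace X - {x \<in> topspace X. f x = id x}"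
    by (auto simp: moved_def)
  ultimately show ?thesis by auto
qed

lemma moved_subset_support: "moved X f \<subseteq> support X f"
  unfolding support_def by (rule closure_of_subset) (auto simp: moved_def)

lemma closedin_support: "closedin X (support X f)"
  by (simp add: support_def)

lemma support_subset_topspace: "support X f \<subseteq> topspace X"
  by (simp add: support_def closure_of_subset_topspace)

lemma support_disjoint_openin:
  assumes "openin X T" "T \<inter> moved X f = {}" shows "T \<inter> support X f = {}"
  using assms openin_Int_closure_of_eq_empty unfolding support_def by metis

lemma fixes_iff: "x \<in> topspace X \<Longrightarrow> x \<notin> moved X f \<longleftrightarrow> f x = x"
  by (auto simp: moved_def)

lemma not_moved: "x \<in> topspace X \<Longrightarrow> support X f \<subseteq> V \<Longrightarrow> x \<notin> V \<Longrightarrow> f x = x"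
  using moved_subset_support[of f] by (auto simp: moved_def)

lemma moved_invariant:
  assumes "f \<in> carrier H" "x \<in> moved X f" shows "f x \<in> moved X f"
  using assms act_inj act_closed by (auto simp: moved_def)

lemma moved_one: "moved X \<one> = {}"
  by (auto simp: moved_def act_one)

lemma moved_inv: assumes "f \<in> carrier H" shows "moved X (inv f) = moved X f"
proof -
  have "(inv f) x = x \<longleftrightarrow> f x = x" if "x \<in> topspace X" for x
    using that assms by (metis act_inv)
  then show ?thesis by (auto simp: moved_def)
qed

lemma moved_mult:
  assumes "f \<in> carrier H" "g \<in> carrier H" shows "moved X (f \<otimes> g) \<subseteq> moved X f \<union> moved X g"
  using assms by (auto simp: moved_def act_mult)

lemma moved_conj:
  assumes "f \<in> carrier H" "g \<in> carrier H" shows "moved X (f \<otimes> g \<otimes> inv f) = f ` moved X g"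
proof (intro equalityI subsetI)
  fix x assume "x \<in> moved X (f \<otimes> g \<otimes> inv f)"
  then have x: "x \<in> topspace X" "f (g ((inv f) x)) \<noteq> x"
    using assms by (auto simp: moved_def act_mult act_closed)
  then have "(inv f) x \<in> moved X g"
    using assms by (auto simp: moved_def act_closed)
  then show "x \<in> f ` moved X g"
    using assms x by (metis act_inv(2) imageI)
next
  fix x assume "x \<in> f ` moved X g"
  then obtain y where y: "y \<in> topspace X" "g y \<noteq> y" "x = f y"
    by (auto simp: moved_def)
  then have "f (g y) \<noteq> f y"
    using assms act_inj act_closed by metis
  then show "x \<in> moved X (f \<otimes> g \<otimes> inv f)"
    using assms y by (simp add: moved_def act_mult act_closed)
qed

lemma support_conj:
  assumes "f \<in> carrier H" "g \<in> carrier H" shows "support X (f \<otimes> g \<otimes> inv f) = f ` support X g"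
  unfolding support_def moved_conj[OF assms]
  using homeomorphic_map_closure_of[OF homeo[OF assms(1)], of "moved X g"] by (simp add: moved_def)

text \<open>A moved set is invariant under its own map, so whichever map moves \<open>x\<close>, the
  other one fixes both \<open>x\<close> and its image.\<close>

lemma disjoint_commute:
  assumes f: "f \<in> carrier H" and g: "g \<in> carrier H" and disj: "moved X f \<inter> moved X g = {}"
  shows "f \<otimes> g = g \<otimes> f"
proof (rule act_eqI)
  fix x assume x: "x \<in> topspace X"
  consider "x \<in> moved X f" "x \<notin> moved X g" "f x \<notin> moved X g"
    | "x \<in> moved X g" "x \<notin> moved X f" "g x \<notin> moved X f"
    | "x \<notin> moved X f" "x \<notin> moved X g"
    using moved_invariant[OF f, of x] moved_invariant[OF g, of x] disj by blast
  then have "f (g x) = g (f x)"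
    using x f g by cases (simp_all add: fixes_iff act_closed)
  then show "(f \<otimes> g) x = (g \<otimes> f) x"
    using f g x by (simp add: act_mult)
qed (use f g in auto)

text \<open>Separate \<open>f x\<close> from \<open>x\<close> and pull the neighbourhood of
  \<open>f x\<close> back along \<open>f\<close>.\<close>

lemma displaced_neighbourhood:
  assumes f: "f \<in> carrier H" and x: "x \<in> T" "openin X T" and "f x \<noteq> x"
  obtains V where "openin X V" "x \<in> V" "V \<subseteq> T" "f ` V \<inter> V = {}"
proof -
  have xX: "x \<in> topspace X" using x openin_subset by fastforce
  then obtain A B where AB: "openin X A" "openin X B" "f x \<in> A" "x \<in> B" "disjnt A B"
    using Hausdorff assms(4) act_closed[OF f xX] xX unfolding Hausdorff_space_def by metis
  let ?V = "T \<inter> B \<inter> {y \<in> topspace X. f y \<in> A}"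
  have "openin X {y \<in> topspace X. f y \<in> A}"
    using AB(1) homeo[OF f] openin_continuous_map_preimage homeomorphic_imp_continuous_map by blast
  then have "openin X ?V"
    using AB x by auto
  moreover have "x \<in> ?V" "?V \<subseteq> T" "f ` ?V \<inter> ?V = {}"
    using AB x xX by (auto simp: disjnt_def)
  ultimately show thesis
    using that[of ?V] by blast
qed

section \<open>Disjointness tested by commutators\<close>

lemma local_mover:
  assumes "openin X V" "x \<in> V"
  obtains g where "g \<in> carrier H" "support X g \<subseteq> V" "g x \<noteq> x" "(g [^] (12::nat)) x \<noteq> x"
proof -
  obtain g where g: "g \<in> carrier H" "support X g \<subseteq> V" "(g ^^ 12) x \<noteq> x"
    using moves[OF assms] by blast
  have x: "x \<in> topspace X" using assms openin_subset by fastforce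
  have "g x \<noteq> x"
  proof
    assume "g x = x"
    then have "(g ^^ n) x = x" for n by (induction n) auto
    then show False using g by simp
  qed
  then show thesis using g x that act_pow by simp
qed

text \<open>Here \<open>[b, h]\<close> is \<open>b\<close> times the conjugate \<open>c\<close> of
  its inverse by \<open>h\<close>. As \<open>c\<close> lives in the translate of \<open>V\<close> by
  \<open>h\<close>, away from \<open>V\<close>, it commutes with \<open>a\<close> and drops out of
  the outer commutator.\<close>

lemma commutator_with_displaced:
  assumes "a \<in> carrier H" "b \<in> carrier H" "h \<in> carrier H"
    and a: "moved X a \<subseteq> V" and b: "moved X b \<subseteq> V" and "h ` V \<inter> V = {}"
  shows "commutator H a (commutator H b h) = commutator H a b"
proof -
  define c where "c = h \<otimes> inv b \<otimes> inv h"
  have c: "c \<in> carrier H" using assms by (simp add: c_def)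
  have "moved X c \<subseteq> h ` V"
    using assms moved_conj[of h "inv b"] moved_inv[of b] by (auto simp: c_def)
  then have "a \<otimes> c = c \<otimes> a"
    using assms c by (intro disjoint_commute) auto
  then have ac: "c \<otimes> inv a \<otimes> inv c = inv a"
    using assms c by (metis inv_closed inv_solve_right' inv_solve_left m_assoc m_closed)
  have "commutator H b h = b \<otimes> c"
    using assms by (simp add: commutator_def c_def m_assoc)
  then have "commutator H a (commutator H b h) = a \<otimes> b \<otimes> (c \<otimes> inv a \<otimes> inv c) \<otimes> inv b"
    using assms c by (simp add: commutator_def m_assoc inv_mult_group)
  also have "\<dots> = commutator H a b"
    using ac by (simp add: commutator_def)
  finally show ?thesis .
qed

text \<open>If \<open>h\<close> does not commute with \<open>f\<close>, it displaces some
  \<open>V\<close> inside the moved set of \<open>f\<close>. For \<open>a\<close>, \<open>b\<close>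
  supported in \<open>V\<close> the double commutator collapses to \<open>[a, b]\<close>, which is
  supported in \<open>V\<close> and so commutes with \<open>g\<close>. It is nontrivial because
  \<open>b\<close> is confined to a smaller \<open>W\<close> that \<open>a\<close> carries off
  itself.\<close>

lemma disjoint_imp_alg_disjoint:
  assumes f: "f \<in> carrier H" and g: "g \<in> carrier H" and disj: "moved X f \<inter> moved X g = {}"
  shows "alg_disjoint H f g"
  unfolding alg_disjoint_def
proof (intro ballI impI)
  fix h assume h: "h \<in> carrier H" "f \<otimes> h \<noteq> h \<otimes> f"
  then obtain x where x: "x \<in> moved X f" "h x \<noteq> x"
    using disjoint_commute[OF f h(1)] by (auto simp: moved_def)
  then obtain V where V: "openin X V" "x \<in> V" "V \<subseteq> moved X f" "h ` V \<inter> V = {}"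
    using displaced_neighbourhood[OF h(1) _ openin_moved[OF f]] by metis
  obtain a where a: "a \<in> carrier H" "support X a \<subseteq> V" "a x \<noteq> x"
    using local_mover[OF V(1,2)] by metis
  obtain W where W: "openin X W" "x \<in> W" "W \<subseteq> V" "a ` W \<inter> W = {}"
    using displaced_neighbourhood[OF a(1) V(2,1) a(3)] by metis
  obtain b where b: "b \<in> carrier H" "support X b \<subseteq> W" "b x \<noteq> x"
    using local_mover[OF W(1,2)] by metis
  have xX: "x \<in> topspace X" using x by (simp add: moved_def)
  have mov: "moved X a \<subseteq> V" "moved X b \<subseteq> V"
    using a b W moved_subset_support by blast+
  have nc: "a \<otimes> b \<noteq> b \<otimes> a"
  proof
    assume "a \<otimes> b = b \<otimes> a"
    then have "a (b x) = b (a x)"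
      using a b xX by (metis act_mult)
    also have "b (a x) = a x"
      using W a b xX by (intro not_moved[OF _ b(2)]) (auto simp: act_closed)
    finally show False
      using act_inj[OF a(1), of "b x" x] act_closed b xX by blast
  qed
  have eq: "commutator H a (commutator H b h) = commutator H a b"
    using a b h V mov by (intro commutator_with_displaced[of _ _ _ V]) auto
  have comm: "a \<otimes> g = g \<otimes> a" "b \<otimes> g = g \<otimes> b"
    using a b g mov V disj by (auto intro!: disjoint_commute)
  have "moved X (commutator H a b) \<subseteq> V"
    using a(1) b(1) mov moved_mult moved_inv unfolding commutator_def
    by (smt (verit, best) Un_subset_iff inv_closed m_closed subset_trans)
  then have "commutator H a b \<otimes> g = g \<otimes> commutator H a b"
    using a b g V disj by (intro disjoint_commute) (auto simp: commutator_closed)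
  moreover have "commutator H a b \<noteq> \<one>"
  proof
    assume "commutator H a b = \<one>"
    then have "a \<otimes> b = b \<otimes> a"
      using a b unfolding commutator_def
      by (metis inv_solve_right' inv_closed l_one m_closed one_closed inv_inv)
    then show False using nc by simp
  qed
  ultimately show "\<exists>a\<in>carrier H. \<exists>b\<in>carrier H. a \<otimes> g = g \<otimes> a \<and> b \<otimes> g = g \<otimes> b \<and>
      commutator H a (commutator H b h) \<noteq> \<one> \<and>
      commutator H a (commutator H b h) \<otimes> g = g \<otimes> commutator H a (commutator H b h)"
    using a(1) b(1) eq comm by (intro bexI[of _ a] bexI[of _ b]) auto
qed

text \<open>Only the moved set of \<open>b\<close> and its translate by \<open>a\<close> enter the
  bound. Applied twice, it controls \<open>[a, [b, h]]\<close> by the moved set of \<open>h\<close>,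
  however large the supports of \<open>a\<close> and \<open>b\<close> are.\<close>

lemma moved_commutator:
  assumes "a \<in> carrier H" "b \<in> carrier H"
  shows "moved X (commutator H a b) \<subseteq> a ` moved X b \<union> moved X b"
  using moved_mult[of "a \<otimes> b \<otimes> inv a" "inv b"] moved_conj[of a b] moved_inv[of b] assms
  by (simp add: commutator_def)

text \<open>The commutator \<open>k = [a, [b, h]]\<close> is supported in the four translates of a small
  set \<open>U\<close> by \<open>1, a, b, ab\<close>. As \<open>k\<close> commutes with \<open>g\<close>, five successive points of a \<open>g\<close>-orbit
  lie in these sets, so two of them lie in the same one, although \<open>g\<close> displaces \<open>U\<close>.\<close>

lemma alg_disjoint_imp_disjoint:
  assumes f: "f \<in> carrier H" and g: "g \<in> carrier H" and alg: "alg_disjoint H f g"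
  shows "moved X f \<inter> moved X (g [^] (12::nat)) = {}"
proof (rule ccontr)
  assume "moved X f \<inter> moved X (g [^] (12::nat)) \<noteq> {}"
  then obtain x where x: "x \<in> topspace X" "f x \<noteq> x" "(g ^^ 12) x \<noteq> x"
    using act_pow[OF g, of _ 12] by (auto simp: moved_def)
  have gd: "g [^] (d::nat) \<in> carrier H" for d using g by simp
  have per: "(g [^] d) x \<noteq> x" if "d \<in> {1, 2, 3, 4}" for d :: nat
  proof
    assume "(g [^] d) x = x"
    then have *: "(g ^^ d) x = x" using act_pow g x by simp
    have "((g ^^ d) ^^ q) x = x" for q
      by (induction q) (simp_all add: *)
    then have "(g ^^ (d * q)) x = x" for q
      by (simp add: funpow_mult)
    \<comment> \<open>The values 12, 6, 4, 3 are 12 divided by \<open>d\<close> = 1, 2, 3,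
      4.\<close>
    from this[of 12] this[of 6] this[of 4] this[of 3] show False
      using that x by auto
  qed
  \<comment> \<open>The final \<open>U\<close> is displaced by \<open>f\<close> and by the first
    four powers of \<open>g\<close>. Displacement by \<open>f\<close> ensures that an
    \<open>h\<close> supported in \<open>U\<close> and moving \<open>x\<close> does not commute with
    \<open>f\<close>, so that \<open>alg\<close> applies to it.\<close>
  obtain U0 where U0: "openin X U0" "x \<in> U0" "f ` U0 \<inter> U0 = {}"
    using displaced_neighbourhood[OF f x(1) openin_topspace x(2)] by metis
  obtain U1 where U1: "openin X U1" "x \<in> U1" "U1 \<subseteq> U0" "(g [^] (1::nat)) ` U1 \<inter> U1 = {}"
    using displaced_neighbourhood[OF gd U0(2,1) per[of 1]] by blast
  obtain U2 where U2: "openin X U2" "x \<in> U2" "U2 \<subseteq> U1" "(g [^] (2::nat)) ` U2 \<inter> U2 = {}"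
    using displaced_neighbourhood[OF gd U1(2,1) per[of 2]] by blast
  obtain U3 where U3: "openin X U3" "x \<in> U3" "U3 \<subseteq> U2" "(g [^] (3::nat)) ` U3 \<inter> U3 = {}"
    using displaced_neighbourhood[OF gd U2(2,1) per[of 3]] by blast
  obtain U where U: "openin X U" "x \<in> U" "U \<subseteq> U3" "(g [^] (4::nat)) ` U \<inter> U = {}"
    using displaced_neighbourhood[OF gd U3(2,1) per[of 4]] by blast
  have UX: "U \<subseteq> topspace X" using U openin_subset by blast
  have disj: "(g [^] d) u \<notin> U" if "u \<in> U" "d \<in> {1, 2, 3, 4}" for u and d :: nat
  proof -
    have sub: "U \<subseteq> U1" "U \<subseteq> U2" "U \<subseteq> U3" using U U1 U2 U3 by auto
    have "\<forall>v\<in>U1. (g [^] (1::nat)) v \<notin> U1" "\<forall>v\<in>U2. (g [^] (2::nat)) v \<notin> U2"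
      "\<forall>v\<in>U3. (g [^] (3::nat)) v \<notin> U3" "\<forall>v\<in>U. (g [^] (4::nat)) v \<notin> U"
      using U1(4) U2(4) U3(4) U(4) by blast+
    then show ?thesis using that(2) subsetD[OF sub(1)] subsetD[OF sub(2)] subsetD[OF sub(3)] that(1)
      by (elim insertE) (metis empty_iff)+
  qed
  obtain h where h: "h \<in> carrier H" "support X h \<subseteq> U" "h x \<noteq> x"
    using local_mover[OF U(1,2)] by metis
  have hU: "moved X h \<subseteq> U" using h moved_subset_support by blast
  have "f \<otimes> h \<noteq> h \<otimes> f"
  proof
    assume "f \<otimes> h = h \<otimes> f"
    then have "f (h x) = h (f x)" using f h x by (metis act_mult)
    also have "h (f x) = f x"
    proof (rule not_moved[OF _ h(2)])
      show "f x \<notin> U" using U0(2,3) U1(3) U2(3) U3(3) U(3) by blast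
    qed (use f x act_closed in auto)
    finally show False using act_inj[OF f, of "h x" x] act_closed[OF h(1)] x h by blast
  qed
  then obtain a b where ab: "a \<in> carrier H" "b \<in> carrier H" "a \<otimes> g = g \<otimes> a" "b \<otimes> g = g \<otimes> b"
    and k1: "commutator H a (commutator H b h) \<noteq> \<one>"
    and kg: "commutator H a (commutator H b h) \<otimes> g = g \<otimes> commutator H a (commutator H b h)"
    using alg h(1) unfolding alg_disjoint_def by metis
  define c where "c = commutator H b h"
  define k where "k = commutator H a c"
  have c: "c \<in> carrier H" and k: "k \<in> carrier H"
    using ab h by (auto simp: c_def k_def commutator_closed)
  have mc: "moved X c \<subseteq> b ` U \<union> U"
    unfolding c_def by (rule subset_trans[OF moved_commutator[OF ab(2) h(1)] Un_mono[OF image_mono[OF hU] hU]])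
  have mk0: "moved X k \<subseteq> a ` (b ` U \<union> U) \<union> (b ` U \<union> U)"
    unfolding k_def by (rule subset_trans[OF moved_commutator[OF ab(1) c] Un_mono[OF image_mono[OF mc] mc]])
  let ?S = "{\<one>, a, b, a \<otimes> b}"
  have SH: "s \<in> carrier H" if "s \<in> ?S" for s using that ab by auto
  have Sg: "s \<otimes> g = g \<otimes> s" if "s \<in> ?S" for s
    using that ab g by (auto simp: m_assoc) (metis m_assoc)
  have mk: "\<exists>s\<in>?S. \<exists>u\<in>U. y = s u" if y: "y \<in> moved X k" for y
  proof -
    obtain u where u: "u \<in> U" "y = a (b u) \<or> y = a u \<or> y = b u \<or> y = u"
      using subsetD[OF mk0 y] by (elim UnE imageE) auto
    moreover have "(a \<otimes> b) u = a (b u)" "\<one> u = u"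
      using u UX ab by (auto intro!: act_mult act_one)
    ultimately have "\<exists>s\<in>?S. y = s u"
      by (metis insertI1 insertI2)
    then show ?thesis using u(1) by blast
  qed
  have "moved X k \<noteq> {}"
    using k1 faithful[OF k] by (auto simp: moved_def k_def c_def)
  then obtain p where p: "p \<in> moved X k" by blast
  have pX: "p \<in> topspace X" using p by (simp add: moved_def)
  have pj: "(g [^] j) p \<in> moved X k" for j :: nat
  proof -
    have "k \<otimes> (g [^] j) = (g [^] j) \<otimes> k"
      using kg g k group_commutes_pow[of g k j] by (simp add: k_def c_def)
    then have "k ((g [^] j) p) = (g [^] j) (k p)"
      using k g pX by (metis act_mult gd)
    then show ?thesis
      using p act_inj[OF gd, of "k p" p] act_closed[OF gd pX] act_closed[OF k pX] by (auto simp: moved_def)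
  qed
  then have "\<forall>j::nat. \<exists>s. s \<in> ?S \<and> (\<exists>u\<in>U. (g [^] j) p = s u)" using mk by (meson bexE)
  then obtain s where "\<forall>j::nat. s j \<in> ?S \<and> (\<exists>u\<in>U. (g [^] j) p = s j u)"
    using choice by metis
  then have s: "\<And>j::nat. s j \<in> ?S" "\<And>j. \<exists>u\<in>U. (g [^] j) p = s j u" by blast+
  \<comment> \<open>Five exponents 0 to 4 meet four translating elements; some of these may
    coincide, hence only an upper bound on the cardinality.\<close>
  have "card (s ` {..4}) \<le> card ?S"
    using s(1) by (intro card_mono) auto
  also have "card ?S \<le> 4" by (simp add: card_insert_if)
  finally have "\<not> inj_on s {..4}" by (intro pigeonhole) simp
  then obtain i j where ij: "i < j" "j \<le> 4" "s i = s j"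
    unfolding inj_on_def by (metis atMost_iff linorder_neqE_nat)
  obtain u v where uv: "u \<in> U" "(g [^] i) p = s j u" "v \<in> U" "(g [^] j) p = s j v"
    using s(2)[of i] s(2)[of j] ij by auto
  have uX: "u \<in> topspace X" and vX: "v \<in> topspace X" using UX uv by auto
  let ?d = "j - i"
  \<comment> \<open>The common translating element commutes with powers of \<open>g\<close> and can
    be cancelled: \<open>u\<close> and \<open>v\<close>, both in \<open>U\<close>, then differ by a
    power of \<open>g\<close> with exponent between 1 and 4.\<close>
  have sj: "s j \<in> carrier H" "s j \<otimes> (g [^] ?d) = (g [^] ?d) \<otimes> s j"
    using SH[OF s(1)] Sg[OF s(1)] group_commutes_pow[of g "s j" ?d] g by auto
  have "s j v = (g [^] ?d \<otimes> g [^] i) p"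
    using uv ij g by (simp add: nat_pow_mult)
  also have "\<dots> = (g [^] ?d) (s j u)" using uv(2) act_mult gd pX by simp
  also have "\<dots> = s j ((g [^] ?d) u)"
    by (simp only: act_mult[OF sj(1) gd uX, symmetric] act_mult[OF gd sj(1) uX, symmetric] sj(2))
  finally have "v = (g [^] ?d) u"
    by (rule act_inj[OF sj(1) vX act_closed[OF gd uX]])
  moreover have "?d \<in> {1, 2, 3, 4}" using ij by auto
  ultimately show False using disj[OF uv(1)] uv(3) by blast
qed

text \<open>If the supports are nested, the twelfth power of an admissible \<open>g\<close> moves an
  open set that misses the moved set of \<open>f\<close>, hence also its closure, and so commutes
  with \<open>k\<close>. Conversely, around a point \<open>x\<close> moved by \<open>k\<close> off
  the support of \<open>f\<close> there is a \<open>V\<close>, also off it, that \<open>k\<close>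
  displaces. An element \<open>g\<close> living in \<open>V\<close> is admissible and fixes
  \<open>k x\<close>, but its twelfth power moves \<open>x\<close>, so \<open>k\<close> does not
  commute with that power.\<close>

lemma alg_subsupport_iff:
  assumes k: "k \<in> carrier H" and f: "f \<in> carrier H"
  shows "alg_subsupport H k f \<longleftrightarrow> support X k \<subseteq> support X f"
proof
  assume sub: "support X k \<subseteq> support X f"
  show "alg_subsupport H k f"
    unfolding alg_subsupport_def
  proof (intro ballI impI)
    fix g assume g: "g \<in> carrier H" "alg_disjoint H f g"
    have "moved X (g [^] (12::nat)) \<inter> support X f = {}"
      using alg_disjoint_imp_disjoint[OF f g] g
      by (intro support_disjoint_openin openin_moved) auto
    then show "k \<otimes> g [^] (12::nat) = g [^] (12::nat) \<otimes> k"
      using sub moved_subset_support[of k] g k by (intro disjoint_commute) auto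
  qed
next
  assume alg: "alg_subsupport H k f"
  have "moved X k \<subseteq> support X f"
  proof (rule subsetI, rule ccontr)
    fix x assume x: "x \<in> moved X k" "x \<notin> support X f"
    then have xX: "x \<in> topspace X" and kx: "k x \<noteq> x" by (auto simp: moved_def)
    have "openin X (topspace X - support X f)"
      using closedin_support by blast
    then obtain V where V: "openin X V" "x \<in> V" "V \<subseteq> topspace X - support X f" "k ` V \<inter> V = {}"
      using displaced_neighbourhood[OF k _ _ kx, of "topspace X - support X f"] x xX by blast
    obtain g where g: "g \<in> carrier H" "support X g \<subseteq> V" "(g [^] (12::nat)) x \<noteq> x"
      using local_mover[OF V(1,2)] by metis
    have "moved X f \<inter> moved X g = {}"
      using moved_subset_support[of f] moved_subset_support[of g] V g by blast
    then have eq: "k \<otimes> g [^] (12::nat) = g [^] (12::nat) \<otimes> k"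
      using alg disjoint_imp_alg_disjoint[OF f g(1)] g(1) unfolding alg_subsupport_def by blast
    have gk: "g (k x) = k x"
      using V k xX by (intro not_moved[OF _ g(2)]) (auto simp: act_closed)
    then have "(g ^^ n) (k x) = k x" for n by (induction n) auto
    then have "(g [^] (12::nat)) (k x) = k x"
      using act_pow g act_closed k xX by simp
    moreover have "(g [^] (12::nat)) (k x) = k ((g [^] (12::nat)) x)"
      using eq g k xX by (metis act_mult nat_pow_closed)
    ultimately have "(g [^] (12::nat)) x = x"
      using act_inj[OF k, of "(g [^] (12::nat)) x" x] act_closed g xX by auto
    then show False using g by simp
  qed
  then show "support X k \<subseteq> support X f"
    using closedin_support unfolding support_def[of X k] by (rule closure_of_minimal)
qed

lemma support_empty_iff: "f \<in> carrier H \<Longrightarrow> support X f = {} \<longleftrightarrow> f = \<one>"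
  using moved_subset_support[of f] faithful[of f] moved_one fixes_iff[of _ f]
  by (metis closure_of_empty empty_iff subset_empty support_def)

text \<open>Disjointness phrased through containment, so that it passes through an isomorphism
  exactly and not only up to twelfth powers. Openness of supports matters: a nonempty intersection
  of two of them is open and contains the support of a nontrivial element.\<close>

lemma disjoint_support_iff:
  assumes f: "f \<in> carrier H" and g: "g \<in> carrier H"
  shows "support X f \<inter> support X g = {} \<longleftrightarrow>
    (\<forall>k\<in>carrier H. alg_subsupport H k f \<and> alg_subsupport H k g \<longrightarrow> k = \<one>)"
proof
  assume "support X f \<inter> support X g = {}"
  then show "\<forall>k\<in>carrier H. alg_subsupport H k f \<and> alg_subsupport H k g \<longrightarrow> k = \<one>"
    using assms by (auto simp: alg_subsupport_iff support_empty_iff[symmetric])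
next
  assume *: "\<forall>k\<in>carrier H. alg_subsupport H k f \<and> alg_subsupport H k g \<longrightarrow> k = \<one>"
  show "support X f \<inter> support X g = {}"
  proof (rule ccontr)
    assume "support X f \<inter> support X g \<noteq> {}"
    then obtain x where x: "x \<in> support X f \<inter> support X g" by blast
    moreover have "openin X (support X f \<inter> support X g)"
      using open_support f g by auto
    ultimately obtain k where k: "k \<in> carrier H" "support X k \<subseteq> support X f \<inter> support X g" "k x \<noteq> x"
      using local_mover by metis
    then have "k = \<one>" using * f g by (simp add: alg_subsupport_iff)
    then show False using k x act_one support_subset_topspace by blast
  qed
qed

lemma support_neighbourhood:
  assumes "openin X V" "x \<in> V"
  obtains g where "g \<in> carrier H" "support X g \<subseteq> V" "x \<in> support X g"
proof -
  obtain g where "g \<in> carrier H" "support X g \<subseteq> V" "g x \<noteq> x"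
    using local_mover[OF assms] by metis
  moreover have "x \<in> topspace X" using assms openin_subset by fastforce
  ultimately show thesis using that moved_subset_support[of g] by (auto simp: moved_def)
qed

end

section \<open>Reconstruction of the space\<close>

locale rubin_pair = H: rubin_action H X + K: rubin_action K Y
  for H :: "('a \<Rightarrow> 'a) monoid" and X :: "'a topology"
    and K :: "('b \<Rightarrow> 'b) monoid" and Y :: "'b topology" +
  fixes \<Phi> :: "('a \<Rightarrow> 'a) \<Rightarrow> 'b \<Rightarrow> 'b"
  assumes iso: "\<Phi> \<in> iso H K"
begin

text \<open>A point is encoded by the family of group elements whose supports contain it, and such
  families can be compared across \<Phi>.\<close>

definition corresponds :: "'a \<Rightarrow> 'b \<Rightarrow> bool" where
  "corresponds x y \<longleftrightarrow> x \<in> topspace X \<and> y \<in> topspace Y \<and>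
     (\<forall>f\<in>carrier H. x \<in> support X f \<longleftrightarrow> y \<in> support Y (\<Phi> f))"

definition point_map :: "'a \<Rightarrow> 'b" where
  "point_map x = (THE y. corresponds x y)"

lemma iso_closed: "f \<in> carrier H \<Longrightarrow> \<Phi> f \<in> carrier K"
  using iso by (auto simp: iso_def bij_betw_def)

lemma iso_surj: "h \<in> carrier K \<Longrightarrow> \<exists>f\<in>carrier H. h = \<Phi> f"
  using iso by (auto simp: iso_def bij_betw_def)

sublocale hom: group_hom H K \<Phi>
  using iso by unfold_locales (simp add: iso_def)

lemma iso_one_iff: "f \<in> carrier H \<Longrightarrow> \<Phi> f = \<one>\<^bsub>K\<^esub> \<longleftrightarrow> f = \<one>\<^bsub>H\<^esub>"
  using iso hom.hom_one H.one_closed unfolding iso_def bij_betw_def inj_on_def by fastforce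

lemma support_subset_iff:
  assumes "f \<in> carrier H" "g \<in> carrier H"
  shows "support Y (\<Phi> f) \<subseteq> support Y (\<Phi> g) \<longleftrightarrow> support X f \<subseteq> support X g"
  using iso_alg_subsupport[OF H.is_group K.is_group iso assms(2,1)] assms
  by (simp add: H.alg_subsupport_iff K.alg_subsupport_iff iso_closed)

lemma disjoint_iff_iso:
  assumes "f \<in> carrier H" "g \<in> carrier H"
  shows "support Y (\<Phi> f) \<inter> support Y (\<Phi> g) = {} \<longleftrightarrow> support X f \<inter> support X g = {}"
proof -
  have "carrier K = \<Phi> ` carrier H" using iso by (auto simp: iso_def bij_betw_def)
  then show ?thesis
    using assms
    by (simp add: H.disjoint_support_iff K.disjoint_support_iff iso_closed iso_one_iff
        iso_alg_subsupport[OF H.is_group K.is_group iso])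
qed

text \<open>The finite intersection is an open set around \<open>x\<close> and so contains the
  support of a nontrivial \<open>g\<close>. The support of \<open>\<Phi> g\<close> is nonempty and
  lies in all the corresponding supports in \<open>Y\<close>.\<close>

lemma finite_intersection_support:
  assumes "finite F" "F \<subseteq> {f \<in> carrier H. x \<in> support X f}" "x \<in> topspace X"
  shows "\<exists>y\<in>topspace Y. \<forall>f\<in>F. y \<in> support Y (\<Phi> f)"
proof -
  have op: "openin X (topspace X \<inter> \<Inter>(support X ` F))"
    using assms by (intro openin_Int_Inter) (auto intro: H.open_support)
  have "x \<in> topspace X \<inter> \<Inter>(support X ` F)" using assms by auto
  then obtain g where g: "g \<in> carrier H" "support X g \<subseteq> topspace X \<inter> \<Inter>(support X ` F)" "x \<in> support X g"
    using H.support_neighbourhood[OF op] by metis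
  then have "\<Phi> g \<noteq> \<one>\<^bsub>K\<^esub>" using H.support_empty_iff iso_one_iff by auto
  then obtain y where y: "y \<in> support Y (\<Phi> g)"
    using K.support_empty_iff[OF iso_closed[OF g(1)]] by blast
  have "y \<in> support Y (\<Phi> f)" if "f \<in> F" for f
  proof -
    have "f \<in> carrier H" "support X g \<subseteq> support X f" using that assms(2) g(2) by auto
    then show ?thesis using y support_subset_iff[OF g(1), of f] by blast
  qed
  then show ?thesis using y K.support_subset_topspace by (intro bexI[of _ y]) auto
qed

lemma corresponds_total:
  assumes x: "x \<in> topspace X"
  obtains y where "corresponds x y"
proof -
  let ?F = "{f \<in> carrier H. x \<in> support X f}"
  let ?C = "(\<lambda>f. support Y (\<Phi> f)) ` ?F"
  \<comment> \<open>Adding the whole space to the family places the common point in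
    \<open>Y\<close>; it is set aside before a finite subfamily is written as an image of group
    elements.\<close>
  have "\<Inter>\<F> \<noteq> {}" if fin: "finite \<F>" and sub: "\<F> \<subseteq> insert (topspace Y) ?C" for \<F>
  proof -
    have "finite (\<F> - {topspace Y})" "\<F> - {topspace Y} \<subseteq> ?C" using fin sub by auto
    from finite_subset_image[OF this]
    obtain F where F: "F \<subseteq> ?F" "finite F" "\<F> - {topspace Y} = (\<lambda>f. support Y (\<Phi> f)) ` F"
      by blast
    obtain y where y: "y \<in> topspace Y" "\<forall>f\<in>F. y \<in> support Y (\<Phi> f)"
      using finite_intersection_support[OF F(2,1) x] by blast
    have "y \<in> C" if "C \<in> \<F>" for C
    proof (cases "C = topspace Y")
      case False
      then have "C \<in> (\<lambda>f. support Y (\<Phi> f)) ` F" using that F(3) by blast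
      then show ?thesis using y(2) by auto
    qed (use y in simp)
    then show ?thesis by blast
  qed
  moreover have "\<forall>C\<in>insert (topspace Y) ?C. closedin Y C"
    using K.closedin_support by auto
  ultimately have "(\<forall>C\<in>insert (topspace Y) ?C. closedin Y C) \<and>
      (\<forall>\<F>. finite \<F> \<and> \<F> \<subseteq> insert (topspace Y) ?C \<longrightarrow> \<Inter>\<F> \<noteq> {})"
    by presburger
  then have "\<Inter>(insert (topspace Y) ?C) \<noteq> {}"
    by (rule K.compact[unfolded compact_space_fip, THEN spec, THEN mp])
  then obtain y where y: "y \<in> topspace Y" "\<And>f. f \<in> ?F \<Longrightarrow> y \<in> support Y (\<Phi> f)"
    by auto
  \<comment> \<open>Compactness gave one implication only. For the other, a \<open>g\<close> whose
    support contains \<open>x\<close> but avoids that of \<open>f\<close> would have an image whose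
    support contains \<open>y\<close> and avoids that of \<open>\<Phi> f\<close>.\<close>
  have "x \<in> support X f" if f: "f \<in> carrier H" "y \<in> support Y (\<Phi> f)" for f
  proof (rule ccontr)
    assume nx: "x \<notin> support X f"
    have op: "openin X (topspace X - support X f)" using H.closedin_support by blast
    obtain g where g: "g \<in> carrier H" "support X g \<subseteq> topspace X - support X f" "x \<in> support X g"
      using H.support_neighbourhood[OF op, of x] x nx by blast
    then have "support Y (\<Phi> f) \<inter> support Y (\<Phi> g) = {}"
      using disjoint_iff_iso[OF f(1) g(1)] by blast
    then show False using y(2)[of g] g f by blast
  qed
  then have "corresponds x y" using x y unfolding corresponds_def by auto
  then show thesis by (rule that)
qed

lemma corresponds_neighbourhood:
  assumes "corresponds x y" "openin Y V" "y \<in> V"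
  obtains f where "f \<in> carrier H" "x \<in> support X f" "support Y (\<Phi> f) \<subseteq> V"
proof -
  obtain h where "h \<in> carrier K" "support Y h \<subseteq> V" "y \<in> support Y h"
    using K.support_neighbourhood[OF assms(2,3)] by blast
  then show thesis using that iso_surj assms(1) unfolding corresponds_def by metis
qed

lemma corresponds_unique:
  assumes "corresponds x y" "corresponds x z" shows "y = z"
proof (rule ccontr)
  assume "y \<noteq> z"
  then obtain V where V: "openin Y V" "y \<in> V" "z \<notin> V"
    using K.Hausdorff assms unfolding Hausdorff_space_def corresponds_def disjnt_iff by metis
  then obtain f where "f \<in> carrier H" "x \<in> support X f" "support Y (\<Phi> f) \<subseteq> V"
    using corresponds_neighbourhood assms(1) by metis
  then show False using assms(2) V unfolding corresponds_def by blast
qed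

lemma corresponds_point_map:
  assumes "x \<in> topspace X" shows "corresponds x (point_map x)"
proof -
  obtain y where "corresponds x y" using corresponds_total[OF assms] .
  then show ?thesis
    unfolding point_map_def by (rule theI) (rule corresponds_unique[OF _ \<open>corresponds x y\<close>])
qed

lemma point_map_eq: "corresponds x y \<Longrightarrow> point_map x = y"
  by (rule corresponds_unique[OF corresponds_point_map]) (auto simp: corresponds_def)

lemma continuous_point_map: "continuous_map X Y point_map"
  unfolding continuous_map_def
proof (intro conjI allI impI)
  show "point_map \<in> topspace X \<rightarrow> topspace Y"
    using corresponds_point_map by (auto simp: corresponds_def)
  fix V assume V: "openin Y V"
  show "openin X {x \<in> topspace X. point_map x \<in> V}"
  proof (subst openin_subopen, intro ballI)
    fix x assume x: "x \<in> {x \<in> topspace X. point_map x \<in> V}"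
    then obtain f where f: "f \<in> carrier H" "x \<in> support X f" "support Y (\<Phi> f) \<subseteq> V"
      using corresponds_neighbourhood[OF corresponds_point_map V] by auto
    have "support X f \<subseteq> {x \<in> topspace X. point_map x \<in> V}"
      using f corresponds_point_map H.support_subset_topspace unfolding corresponds_def by blast
    then show "\<exists>T. openin X T \<and> x \<in> T \<and> T \<subseteq> {x \<in> topspace X. point_map x \<in> V}"
      using f H.open_support by blast
  qed
qed

text \<open>Conjugation by \<open>f\<close> translates supports by \<open>f\<close>, on both sides
  of \<Phi>. Every \<open>g\<close> is the conjugate by \<open>f\<close> of some \<open>g'\<close>,
  so testing \<open>f x\<close> against \<open>g\<close> amounts to testing \<open>x\<close> against
  \<open>g'\<close>.\<close>

lemma point_map_equivariant:
  assumes f: "f \<in> carrier H" and x: "x \<in> topspace X"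
  shows "point_map (f x) = \<Phi> f (point_map x)"
proof (rule point_map_eq)
  let ?y = "point_map x"
  have y: "?y \<in> topspace Y" using corresponds_point_map[OF x] by (simp add: corresponds_def)
  show "corresponds (f x) (\<Phi> f ?y)"
    unfolding corresponds_def
  proof (intro conjI ballI)
    show "f x \<in> topspace X" "\<Phi> f ?y \<in> topspace Y"
      using f x y by (auto simp: H.act_closed K.act_closed iso_closed)
    fix g assume g: "g \<in> carrier H"
    define g' where "g' = inv\<^bsub>H\<^esub> f \<otimes>\<^bsub>H\<^esub> g \<otimes>\<^bsub>H\<^esub> f"
    have g': "g' \<in> carrier H" "g = f \<otimes>\<^bsub>H\<^esub> g' \<otimes>\<^bsub>H\<^esub> inv\<^bsub>H\<^esub> f"
      using f g by (auto simp: g'_def H.m_assoc) (simp add: H.m_assoc[symmetric])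
    have "\<Phi> g = \<Phi> f \<otimes>\<^bsub>K\<^esub> \<Phi> g' \<otimes>\<^bsub>K\<^esub> inv\<^bsub>K\<^esub> (\<Phi> f)"
      using f g' by simp
    then have "support Y (\<Phi> g) = \<Phi> f ` support Y (\<Phi> g')"
      using K.support_conj f g' iso_closed by metis
    then have "\<Phi> f ?y \<in> support Y (\<Phi> g) \<longleftrightarrow> ?y \<in> support Y (\<Phi> g')"
      using K.act_inj[OF iso_closed[OF f]] K.support_subset_topspace y by blast
    also have "\<dots> \<longleftrightarrow> x \<in> support X g'"
      using corresponds_point_map[OF x] g' unfolding corresponds_def by blast
    also have "\<dots> \<longleftrightarrow> f x \<in> support X g"
      using H.support_conj[OF f g'(1)] g'(2) x H.support_subset_topspace
        inj_on_image_mem_iff[OF homeomorphic_imp_injective_map[OF H.homeo[OF f]]] by metis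
    finally show "f x \<in> support X g \<longleftrightarrow> \<Phi> f ?y \<in> support Y (\<Phi> g)" by simp
  qed
qed

lemma inverse_pair: "rubin_pair K Y H X (inv_into (carrier H) \<Phi>)"
  using H.iso_set_sym[OF iso] by unfold_locales

text \<open>Correspondence of points is symmetric under exchanging \<Phi> with its inverse, so the
  continuous point maps of the two instances undo each other.\<close>

lemma homeomorphic_point_map: "homeomorphic_map X Y point_map"
proof -
  interpret inv: rubin_pair K Y H X "inv_into (carrier H) \<Phi>" by (rule inverse_pair)
  have carr: "carrier K = \<Phi> ` carrier H" and inj: "inj_on \<Phi> (carrier H)"
    using iso by (auto simp: iso_def bij_betw_def)
  have "inv.corresponds y x \<longleftrightarrow> corresponds x y" for x y
    unfolding inv.corresponds_def corresponds_def carr using inj by auto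
  then have "homeomorphic_maps X Y point_map inv.point_map"
    unfolding homeomorphic_maps_def
    using continuous_point_map inv.continuous_point_map corresponds_point_map inv.corresponds_point_map
      point_map_eq inv.point_map_eq by metis
  then show ?thesis
    using homeomorphic_map_maps by blast
qed

end

section \<open>Germs in an etale groupoid\<close>

text \<open>In a compact Hausdorff space quasi-components are components, here single points; so
  clopen sets separate \<open>x\<close> from any other point, and compactness of the complement of
  \<open>N\<close> leaves finitely many of them to intersect.\<close>

lemma clopen_neighbourhood:
  assumes cpt: "compact_space X" and Haus: "Hausdorff_space X" and disc: "totally_disconnected_space X"
    and N: "openin X N" "x \<in> N"
  obtains B where "openin X B" "closedin X B" "x \<in> B" "B \<subseteq> N"
proof -
  have x: "x \<in> topspace X" using N openin_subset by fastforce
  have sep: "\<exists>T. openin X T \<and> closedin X T \<and> x \<in> T \<and> y \<notin> T" if "y \<in> topspace X" "y \<noteq> x" for y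
  proof -
    have "connectedin X (connected_component_of_set X x)"
      by (rule connectedin_connected_component_of)
    moreover have "x \<in> connected_component_of_set X x"
      using x by (simp add: connected_component_of_refl)
    ultimately have "connected_component_of_set X x = {x}"
      using disc unfolding totally_disconnected_space_def by (metis empty_iff singletonD)
    then have "\<not> quasi_component_of X x y"
      using that cpt Haus quasi_eq_connected_component_of[of X x] by auto
    then show ?thesis
      using x that unfolding quasi_component_of by blast
  qed
  let ?C = "{topspace X - T | T. openin X T \<and> closedin X T \<and> x \<in> T}"
  have "compactin X (topspace X - N)"
    using N cpt by (intro closedin_compact_space) auto
  moreover have "topspace X - N \<subseteq> \<Union>?C"
  proof
    fix y assume y: "y \<in> topspace X - N"
    then obtain T where "openin X T" "closedin X T" "x \<in> T" "y \<notin> T"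
      using sep[of y] N by blast
    then show "y \<in> \<Union>?C" using y by blast
  qed
  moreover have "\<forall>U\<in>?C. openin X U" by blast
  ultimately obtain F where F: "finite F" "F \<subseteq> ?C" "topspace X - N \<subseteq> \<Union>F"
    unfolding compactin_def by (metis (no_types, lifting))
  let ?B = "topspace X - \<Union>F"
  have "openin X (\<Union>F)" using F by blast
  moreover have "closedin X (\<Union>F)" using F by (intro closedin_Union) auto
  moreover have "x \<in> ?B" "?B \<subseteq> N" using F x by auto
  ultimately show thesis using that[of ?B] by blast
qed

lemma no_isolated_infinite:
  assumes "Hausdorff_space X" "\<forall>x\<in>topspace X. \<not> openin X {x}" "openin X V" "V \<noteq> {}"
  shows "infinite V"
proof
  assume fin: "finite V"
  obtain x where x: "x \<in> V" using assms by blast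
  have VX: "V \<subseteq> topspace X" using assms openin_subset by blast
  have "closedin X (V - {x})"
    using assms fin VX by (intro closedin_Hausdorff_finite) auto
  then have "openin X (V - (V - {x}))" using assms by (intro openin_diff)
  moreover have "V - (V - {x}) = {x}" using x by blast
  ultimately show False using assms x VX by auto
qed

section \<open>Units and cancellation in groupoids\<close>

context groupoid
begin

lemma unit_space_iff: "x \<in> unit_space G \<longleftrightarrow> x \<in> arrows G \<and> rng G x = x"
proof
  assume "x \<in> unit_space G"
  then obtain g where "g \<in> arrows G" "x = rng G g" unfolding unit_space_def by blast
  then show "x \<in> arrows G \<and> rng G x = x" by (simp add: rng_closed rng_rng)
next
  assume "x \<in> arrows G \<and> rng G x = x"
  then show "x \<in> unit_space G" unfolding unit_space_def by (metis imageI)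
qed

lemma unit_arrow: "x \<in> unit_space G \<Longrightarrow> x \<in> arrows G"
  by (simp add: unit_space_iff)

lemma rng_unit: "g \<in> arrows G \<Longrightarrow> rng G g \<in> unit_space G"
  by (simp add: unit_space_def)

lemma src_unit: "g \<in> arrows G \<Longrightarrow> src G g \<in> unit_space G"
  by (simp add: unit_space_iff src_closed rng_src)

lemma unit_rng [simp]: "x \<in> unit_space G \<Longrightarrow> rng G x = x"
  by (simp add: unit_space_iff)

lemma unit_src [simp]: "x \<in> unit_space G \<Longrightarrow> src G x = x"
  by (metis unit_space_iff src_rng)

lemma composableI: "g \<in> arrows G \<Longrightarrow> h \<in> arrows G \<Longrightarrow> src G g = rng G h \<Longrightarrow> (g, h) \<in> composable G"
  by (simp add: composable_def)

lemma mult_inv_cancel_right: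
  assumes "g \<in> arrows G" "h \<in> arrows G" "src G g = src G h"
  shows "gmult G (gmult G g (ginv G h)) h = g"
proof -
  have "gmult G (gmult G g (ginv G h)) h = gmult G g (gmult G (ginv G h) h)"
    using assms by (intro mult_assoc) (auto intro!: composableI inv_closed simp: rng_inv src_inv)
  then show ?thesis using assms by (metis inv_mult mult_src)
qed

lemma mult_mult_inv:
  assumes "g \<in> arrows G" "h \<in> arrows G" "src G g = rng G h"
  shows "gmult G (gmult G g h) (ginv G h) = g"
proof -
  have "gmult G (gmult G g h) (ginv G h) = gmult G g (gmult G h (ginv G h))"
    using assms by (intro mult_assoc) (auto intro!: composableI inv_closed simp: rng_inv src_inv)
  then show ?thesis using assms by (metis mult_inv mult_src)
qed

lemma mult_inv_cancel_left:
  assumes "g \<in> arrows G" "h \<in> arrows G" "rng G g = rng G h"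
  shows "gmult G h (gmult G (ginv G h) g) = g"
proof -
  have "gmult G (gmult G h (ginv G h)) g = gmult G h (gmult G (ginv G h) g)"
    using assms by (intro mult_assoc) (auto intro!: composableI inv_closed simp: rng_inv src_inv)
  then show ?thesis using assms by (metis mult_inv rng_mult_self)
qed

lemma inv_inv:
  assumes "g \<in> arrows G" shows "ginv G (ginv G g) = g"
proof -
  let ?i = "ginv G g"
  have i: "?i \<in> arrows G" using assms inv_closed by blast
  have "gmult G (gmult G (ginv G ?i) ?i) g = ginv G ?i"
    using assms i by (metis composableI inv_closed inv_mult mult_assoc mult_src rng_inv src_inv)
  moreover have "gmult G (gmult G (ginv G ?i) ?i) g = g"
    using assms i by (metis inv_mult rng_mult_self src_inv)
  ultimately show ?thesis by simp
qed

end

section \<open>Source and range maps, bisections and germs\<close>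

context etale_groupoid
begin

lemma topspace_unit_top: "topspace (unit_top G) = unit_space G"
  using unit_arrow by (auto simp: unit_top_def arrows_def)

lemma topspace_gtop: "topspace (gtop G) = arrows G"
  by (simp add: arrows_def)

lemma openin_arrows: "openin (gtop G) U \<Longrightarrow> U \<subseteq> arrows G"
  by (simp add: arrows_def openin_subset)

lemma continuous_product:
  assumes "continuous_map T (gtop G) a" "continuous_map T (gtop G) b"
    and "\<And>t. t \<in> topspace T \<Longrightarrow> src G (a t) = rng G (b t)"
  shows "continuous_map T (gtop G) (\<lambda>t. gmult G (a t) (b t))"
proof -
  have "continuous_map T (subtopology (prod_topology (gtop G) (gtop G)) (composable G)) (\<lambda>t. (a t, b t))"
    using assms by (intro continuous_map_into_subtopology continuous_map_pairedI)
      (auto simp: composable_def arrows_def dest: continuous_map_image_subset_topspace)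
  from continuous_map_compose[OF this continuous_mult] show ?thesis
    by (simp add: o_def)
qed

lemma continuous_rng: "continuous_map (gtop G) (unit_top G) (rng G)"
proof -
  have "continuous_map (gtop G) (gtop G) (\<lambda>g. gmult G g (ginv G g))"
    by (intro continuous_product continuous_map_id[unfolded id_def] continuous_inv)
       (simp add: rng_inv arrows_def)
  then have "continuous_map (gtop G) (gtop G) (rng G)"
    by (rule continuous_map_eq) (simp add: mult_inv arrows_def)
  then show ?thesis
    unfolding unit_top_def by (intro continuous_map_into_subtopology) (auto simp: rng_unit arrows_def)
qed

lemma continuous_src: "continuous_map (gtop G) (unit_top G) (src G)"
proof -
  have "continuous_map (gtop G) (unit_top G) (rng G \<circ> ginv G)"
    by (rule continuous_map_compose[OF continuous_inv continuous_rng])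
  then show ?thesis by (rule continuous_map_eq) (simp add: rng_inv arrows_def)
qed

lemma openin_inv_preimage:
  "openin (gtop G) U \<Longrightarrow> openin (gtop G) {g \<in> arrows G. ginv G g \<in> U}"
  using openin_continuous_map_preimage[OF continuous_inv] by (simp add: arrows_def)

lemma openin_src_preimage:
  "openin (unit_top G) V \<Longrightarrow> openin (gtop G) {g \<in> arrows G. src G g \<in> V}"
  using openin_continuous_map_preimage[OF continuous_src] by (simp add: arrows_def)

lemma openin_rng_preimage:
  "openin (unit_top G) V \<Longrightarrow> openin (gtop G) {g \<in> arrows G. rng G g \<in> V}"
  using openin_continuous_map_preimage[OF continuous_rng] by (simp add: arrows_def)

lemma rng_injective_neighbourhood:
  assumes "g \<in> arrows G"
  obtains U where "openin (gtop G) U" "g \<in> U" "inj_on (rng G) U" "openin (unit_top G) (rng G ` U)"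
    "homeomorphic_map (subtopology (gtop G) U) (subtopology (unit_top G) (rng G ` U)) (rng G)"
proof -
  obtain U where U: "openin (gtop G) U" "g \<in> U" "openin (unit_top G) (rng G ` U)"
    "homeomorphic_map (subtopology (gtop G) U) (subtopology (unit_top G) (rng G ` U)) (rng G)"
    using local_homeo_rng assms unfolding local_homeomorphism_def topspace_gtop by metis
  then have "inj_on (rng G) U"
    using homeomorphic_imp_injective_map[OF U(4)] openin_subset[OF U(1)] by (simp add: Int_absorb1)
  then show thesis by (rule that[OF U(1,2) _ U(3,4)])
qed

lemma open_map_rng: "open_map (gtop G) (unit_top G) (rng G)"
  unfolding open_map_def
proof (intro allI impI)
  fix W assume W: "openin (gtop G) W"
  show "openin (unit_top G) (rng G ` W)"
  proof (subst openin_subopen, intro ballI)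
    fix x assume "x \<in> rng G ` W"
    then obtain g where g: "g \<in> W" "x = rng G g" by blast
    then have "g \<in> arrows G" using openin_arrows[OF W] by blast
    then obtain U where U: "openin (gtop G) U" "g \<in> U" "openin (unit_top G) (rng G ` U)"
      "homeomorphic_map (subtopology (gtop G) U) (subtopology (unit_top G) (rng G ` U)) (rng G)"
      by (rule rng_injective_neighbourhood)
    have "openin (subtopology (gtop G) U) (W \<inter> U)"
      using W openin_subtopology_Int by blast
    then have "openin (subtopology (unit_top G) (rng G ` U)) (rng G ` (W \<inter> U))"
      using homeomorphic_imp_open_map[OF U(4)] unfolding open_map_def by blast
    then have "openin (unit_top G) (rng G ` (W \<inter> U))"
      using U(3) by (simp add: openin_open_subtopology)
    then show "\<exists>T. openin (unit_top G) T \<and> x \<in> T \<and> T \<subseteq> rng G ` W"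
      using g U(2) by blast
  qed
qed

lemma src_image: "U \<subseteq> arrows G \<Longrightarrow> src G ` U = rng G ` {g \<in> arrows G. ginv G g \<in> U}"
proof (intro equalityI subsetI)
  fix x assume "U \<subseteq> arrows G" "x \<in> src G ` U"
  then obtain g where g: "g \<in> U" "g \<in> arrows G" "x = src G g" by blast
  then have "ginv G g \<in> {g \<in> arrows G. ginv G g \<in> U}" "x = rng G (ginv G g)"
    by (auto simp: inv_inv inv_closed rng_inv)
  then show "x \<in> rng G ` {g \<in> arrows G. ginv G g \<in> U}" by blast
next
  fix x assume "x \<in> rng G ` {g \<in> arrows G. ginv G g \<in> U}"
  then obtain g where g: "g \<in> arrows G" "ginv G g \<in> U" "x = rng G g" by blast
  then have "x = src G (ginv G g)" by (simp add: src_inv)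
  then show "x \<in> src G ` U" using g by blast
qed

lemma openin_src_image: "openin (gtop G) U \<Longrightarrow> openin (unit_top G) (src G ` U)"
  using open_map_rng openin_inv_preimage[of U] src_image[of U] openin_arrows[of U]
  unfolding open_map_def by metis

lemma openin_rng_image: "openin (gtop G) U \<Longrightarrow> openin (unit_top G) (rng G ` U)"
  using open_map_rng unfolding open_map_def by blast

text \<open>Injectivity of the range map near the inverse of \<open>g\<close> is injectivity of the
  source map near \<open>g\<close>.\<close>

lemma open_bisection:
  assumes W: "openin (gtop G) W" and g: "g \<in> W"
  obtains U where "openin (gtop G) U" "g \<in> U" "U \<subseteq> W" "inj_on (rng G) U" "inj_on (src G) U"
proof -
  have ga: "g \<in> arrows G" using assms openin_arrows by blast
  obtain U where U: "openin (gtop G) U" "g \<in> U" "inj_on (rng G) U"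
    using rng_injective_neighbourhood[OF ga] by metis
  obtain V where V: "openin (gtop G) V" "ginv G g \<in> V" "inj_on (rng G) V"
    using rng_injective_neighbourhood[OF inv_closed[OF ga]] by metis
  let ?V = "{g \<in> arrows G. ginv G g \<in> V}"
  have "inj_on (src G) ?V"
  proof (rule inj_onI)
    fix x y assume xy: "x \<in> ?V" "y \<in> ?V" "src G x = src G y"
    then have "rng G (ginv G x) = rng G (ginv G y)"
      by (auto simp: rng_inv)
    then have "ginv G x = ginv G y"
      using inj_onD[OF V(3)] xy by blast
    then show "x = y" using xy inv_inv by (metis (no_types, lifting) mem_Collect_eq)
  qed
  moreover have "openin (gtop G) (W \<inter> U \<inter> ?V)"
    using W U(1) openin_inv_preimage[OF V(1)] by blast
  moreover have "g \<in> W \<inter> U \<inter> ?V" using g U V ga by simp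
  ultimately show thesis
    using that[of "W \<inter> U \<inter> ?V"] U(3) by (meson Int_lower1 Int_lower2 inf.coboundedI1 inj_on_subset)
qed

text \<open>The source map is continuous and open, so where it is injective it is a homeomorphism
  onto its image and compactness comes back to \<open>U\<close>.\<close>

lemma compactin_section:
  assumes U: "openin (gtop G) U" and inj: "inj_on (src G) U" and cpt: "compactin (unit_top G) (src G ` U)"
  shows "compactin (gtop G) U"
proof -
  have tU: "topspace (subtopology (gtop G) U) = U"
    using openin_subset[OF U] by (simp add: Int_absorb1)
  have tS: "topspace (subtopology (unit_top G) (src G ` U)) = src G ` U"
    using openin_subset[OF openin_src_image[OF U]] by (simp add: Int_absorb1)
  have "homeomorphic_map (subtopology (gtop G) U) (subtopology (unit_top G) (src G ` U)) (src G)"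
  proof (rule bijective_open_imp_homeomorphic_map)
    show "continuous_map (subtopology (gtop G) U) (subtopology (unit_top G) (src G ` U)) (src G)"
      using tU by (intro continuous_map_into_subtopology continuous_map_from_subtopology continuous_src) auto
    show "open_map (subtopology (gtop G) U) (subtopology (unit_top G) (src G ` U)) (src G)"
      unfolding open_map_def
      using U openin_src_image by (auto simp: openin_open_subtopology)
  qed (use tU tS inj in auto)
  from homeomorphic_map_compactness[OF this, of U]
  have "compactin (subtopology (gtop G) U) U"
    using cpt openin_subset[OF U] by (simp add: compactin_subtopology Int_absorb1)
  then show ?thesis by (simp add: compactin_subtopology)
qed

definition germ :: "('a \<Rightarrow> 'a) \<Rightarrow> 'a \<Rightarrow> bool" where
  "germ \<alpha> g \<longleftrightarrow> (\<exists>U. openin (gtop G) U \<and> g \<in> U \<and> (\<forall>u\<in>U. \<alpha> (src G u) = rng G u))"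

lemma germ_arrow: "germ \<alpha> g \<Longrightarrow> g \<in> arrows G"
  using openin_arrows unfolding germ_def by blast

lemma germ_eval: "germ \<alpha> g \<Longrightarrow> \<alpha> (src G g) = rng G g"
  unfolding germ_def by blast

lemma openin_germ: "openin (gtop G) {g. germ \<alpha> g}"
  unfolding germ_def by (subst openin_subopen) blast

lemma germ_cong:
  assumes "germ \<alpha> g" and N: "openin (unit_top G) N" "src G g \<in> N" and eq: "\<And>x. x \<in> N \<Longrightarrow> \<alpha> x = \<beta> x"
  shows "germ \<beta> g"
proof -
  obtain U where U: "openin (gtop G) U" "g \<in> U" "\<forall>u\<in>U. \<alpha> (src G u) = rng G u"
    using assms(1) unfolding germ_def by blast
  have "openin (gtop G) (U \<inter> {u \<in> arrows G. src G u \<in> N})"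
    using U openin_src_preimage[OF N(1)] by blast
  then show ?thesis
    unfolding germ_def using U N eq germ_arrow[OF assms(1)]
    by (intro exI[of _ "U \<inter> {u \<in> arrows G. src G u \<in> N}"]) auto
qed

lemma germ_inv:
  assumes "germ \<alpha> g" and inv: "\<And>x. x \<in> unit_space G \<Longrightarrow> \<beta> (\<alpha> x) = x"
  shows "germ \<beta> (ginv G g)"
proof -
  obtain U where U: "openin (gtop G) U" "g \<in> U" "\<forall>u\<in>U. \<alpha> (src G u) = rng G u"
    using assms(1) unfolding germ_def by blast
  let ?V = "{h \<in> arrows G. ginv G h \<in> U}"
  have "\<beta> (src G h) = rng G h" if "h \<in> ?V" for h
    using that U(3) inv[of "rng G h"] by (auto simp: rng_unit src_inv rng_inv dest!: bspec)
  moreover have "ginv G g \<in> ?V"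
    using U germ_arrow[OF assms(1)] by (simp add: inv_inv inv_closed)
  ultimately show ?thesis
    unfolding germ_def using openin_inv_preimage[OF U(1)] by blast
qed

text \<open>Near \<open>gh\<close> every arrow \<open>u\<close> factors as \<open>(u v\<inverse>) v\<close> with \<open>v\<close> near \<open>h\<close>, where
  \<open>u v\<inverse>\<close> is near \<open>g\<close> by continuity; this avoids openness of the multiplication.\<close>

lemma germ_mult:
  assumes g: "germ \<alpha> g" and h: "germ \<beta> h" and comp: "src G g = rng G h"
    and \<gamma>: "\<And>x. x \<in> unit_space G \<Longrightarrow> \<gamma> x = \<alpha> (\<beta> x)"
  shows "germ \<gamma> (gmult G g h)"
proof -
  obtain U where U: "openin (gtop G) U" "g \<in> U" "\<forall>u\<in>U. \<alpha> (src G u) = rng G u"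
    using g unfolding germ_def by blast
  obtain V where V: "openin (gtop G) V" "h \<in> V" "\<forall>v\<in>V. \<beta> (src G v) = rng G v"
    using h unfolding germ_def by blast
  have ga: "g \<in> arrows G" and ha: "h \<in> arrows G" using g h germ_arrow by auto
  let ?k = "gmult G g h"
  have ka: "?k \<in> arrows G" "src G ?k = src G h"
    using ga ha comp by (auto intro: composableI mult_closed src_mult)
  let ?P = "prod_topology (gtop G) (gtop G)"
  have "openin (subtopology ?P (composable G))
      {p \<in> topspace (subtopology ?P (composable G)). (\<lambda>(g, h). gmult G g h) p \<in> U}"
    using openin_continuous_map_preimage[OF continuous_mult U(1)] .
  then obtain T where T: "openin ?P T"
    "{p \<in> topspace (subtopology ?P (composable G)). (\<lambda>(g, h). gmult G g h) p \<in> U} = T \<inter> composable G"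
    unfolding openin_subtopology by metis
  have Teq: "(a, b) \<in> T \<longleftrightarrow> gmult G a b \<in> U" if "(a, b) \<in> composable G" for a b
    using that T(2) by (auto simp: composable_def topspace_gtop set_eq_iff)
  have "(?k, ginv G h) \<in> composable G"
    using ka ha by (intro composableI inv_closed) (auto simp: rng_inv)
  then have "(?k, ginv G h) \<in> T"
    using Teq mult_mult_inv[OF ga ha comp] U(2) by simp
  then obtain A B where AB: "openin (gtop G) A" "openin (gtop G) B" "?k \<in> A" "ginv G h \<in> B" "A \<times> B \<subseteq> T"
    using T(1) unfolding openin_prod_topology_alt by metis
  let ?V = "V \<inter> {v \<in> arrows G. ginv G v \<in> B}"
  let ?N = "A \<inter> {u \<in> arrows G. src G u \<in> src G ` ?V}"
  have "openin (gtop G) ?V" using V(1) openin_inv_preimage[OF AB(2)] by blast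
  then have "openin (gtop G) ?N"
    using AB(1) openin_src_preimage[OF openin_src_image] by blast
  moreover have "?k \<in> ?N" using AB ka V(2) ha by auto
  moreover have "\<gamma> (src G u) = rng G u" if u: "u \<in> ?N" for u
  proof -
    obtain v where v: "v \<in> V" "v \<in> arrows G" "ginv G v \<in> B" "src G u = src G v"
      using u by auto
    have ua: "u \<in> arrows G" "u \<in> A" using u by auto
    have cu: "(u, ginv G v) \<in> composable G"
      using ua v by (intro composableI inv_closed) (auto simp: rng_inv)
    then have "gmult G u (ginv G v) \<in> U"
      using Teq AB(5) ua v by auto
    then have "\<alpha> (src G (gmult G u (ginv G v))) = rng G (gmult G u (ginv G v))"
      using U(3) by blast
    then have "\<alpha> (rng G v) = rng G u"
      using cu v(2) by (simp add: src_mult rng_mult src_inv)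
    then show ?thesis
      using V(3) v \<gamma>[OF src_unit[OF ua(1)]] by simp
  qed
  ultimately show ?thesis unfolding germ_def by blast
qed

end

section \<open>Consequences of essential principality\<close>

locale minimal_cantor_groupoid = etale_groupoid G for G :: "('a, 'm) top_groupoid_scheme" +
  assumes essprin: "essentially_principal G"
    and cantor: "cantor_set (unit_top G)"
    and minimal: "minimal_groupoid G"
begin

lemma Hausdorff_unit: "Hausdorff_space (unit_top G)"
  and compact_unit: "compact_space (unit_top G)"
  and disconnected_unit: "totally_disconnected_space (unit_top G)"
  and not_isolated: "x \<in> unit_space G \<Longrightarrow> \<not> openin (unit_top G) {x}"
  using cantor metrizable_imp_Hausdorff_space topspace_unit_top unfolding cantor_set_def by auto

lemma interior_isotropy: "gtop G interior_of {g \<in> arrows G. rng G g = src G g} = unit_space G"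
  using essprin by (simp add: essentially_principal_def)

lemma openin_unit_space: "openin (gtop G) (unit_space G)"
  using openin_interior_of[of "gtop G" "{g \<in> arrows G. rng G g = src G g}"]
  by (simp add: interior_isotropy)

lemma openin_unit_top: "openin (unit_top G) U \<longleftrightarrow> openin (gtop G) U \<and> U \<subseteq> unit_space G"
  unfolding unit_top_def using openin_open_subtopology[OF openin_unit_space] .

lemma closedin_unit_space: "closedin (gtop G) (unit_space G)"
proof -
  have "continuous_map (gtop G) (gtop G) (rng G)"
    using continuous_rng continuous_map_into_fulltopology unfolding unit_top_def by blast
  then have "closedin (gtop G) {g \<in> topspace (gtop G). rng G g = id g}"
    by (intro closedin_continuous_maps_eq[OF Hausdorff]) auto
  moreover have "{g \<in> topspace (gtop G). rng G g = id g} = unit_space G"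
    by (auto simp: unit_space_iff arrows_def)
  ultimately show ?thesis by simp
qed

lemma clopen_unit_neighbourhood:
  assumes "openin (unit_top G) N" "x \<in> N"
  obtains B where "openin (unit_top G) B" "closedin (unit_top G) B" "x \<in> B" "B \<subseteq> N"
  using clopen_neighbourhood[OF compact_unit Hausdorff_unit disconnected_unit assms] .

text \<open>The quotient of \<open>g\<close> by \<open>h\<close> is a germ of the identity, so all
  arrows near it are isotropic. Essential principality makes it a unit.\<close>

lemma germ_unique:
  assumes g: "germ \<alpha> g" and h: "germ \<alpha> h" and eq: "src G g = src G h"
    and inj: "inj_on \<alpha> (unit_space G)"
  shows "g = h"
proof -
  let ?\<beta> = "inv_into (unit_space G) \<alpha>"
  have inv: "?\<beta> (\<alpha> x) = x" if "x \<in> unit_space G" for x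
    using inj that by simp
  have ga: "g \<in> arrows G" and ha: "h \<in> arrows G" using g h germ_arrow by auto
  have rr: "rng G g = rng G h" using germ_eval[OF g] germ_eval[OF h] eq by simp
  have comp: "src G (ginv G h) = rng G g" using ha rr by (simp add: src_inv)
  let ?k = "gmult G (ginv G h) g"
  have "germ (\<lambda>x. x) ?k"
    using germ_mult[OF germ_inv[where \<beta> = ?\<beta>, OF h inv] g comp, of "\<lambda>x. x"] inv by simp
  then obtain W where W: "openin (gtop G) W" "?k \<in> W" "\<forall>u\<in>W. src G u = rng G u"
    unfolding germ_def by blast
  have "W \<subseteq> {g \<in> arrows G. rng G g = src G g}"
    using W openin_arrows by force
  then have "?k \<in> unit_space G"
    using W interior_of_maximal interior_isotropy by blast
  then have "?k = rng G ?k" by simp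
  also have "\<dots> = src G h"
    using ga ha comp by (simp add: rng_mult composableI inv_closed rng_inv)
  finally have "gmult G h ?k = h" using mult_src[OF ha] by simp
  then show ?thesis using mult_inv_cancel_left[OF ga ha rr] by simp
qed

lemma germ_unit:
  assumes "openin (unit_top G) N" "x \<in> N" "\<And>y. y \<in> N \<Longrightarrow> \<alpha> y = y"
  shows "germ \<alpha> x"
proof -
  have "openin (gtop G) N" "N \<subseteq> unit_space G" using assms(1) openin_unit_top by auto
  moreover have "\<alpha> (src G y) = rng G y" if "y \<in> N" for y
    using that assms(3) calculation(2) by (simp add: subset_iff)
  ultimately show ?thesis unfolding germ_def using assms(2) by blast
qed

section \<open>The full group as the bijections that have a germ everywhere\<close>

lemma full_group_germ:
  assumes "\<alpha> \<in> carrier (topological_full_group G)"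
  shows "\<alpha> \<in> Bij (unit_space G)" and "x \<in> unit_space G \<Longrightarrow> \<exists>g. src G g = x \<and> germ \<alpha> g"
proof -
  show "\<alpha> \<in> Bij (unit_space G)"
    using assms by (simp add: topological_full_group_def homeo_group_def topspace_unit_top)
  assume x: "x \<in> unit_space G"
  obtain U where U: "G_set G U" "openin (gtop G) U" "src G ` U = unit_space G" "\<alpha> = G_set_map G U"
    using assms by (auto simp: topological_full_group_def)
  have inj: "inj_on (src G) U" using U(1) by (simp add: G_set_def)
  have "\<alpha> (src G u) = rng G u" if "u \<in> U" for u
    using that inj by (simp add: U(4) G_set_map_def)
  moreover obtain g where "g \<in> U" "src G g = x" using U(3) x by (metis imageE)
  ultimately show "\<exists>g. src G g = x \<and> germ \<alpha> g"
    unfolding germ_def using U(2) by blast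
qed

lemma Bij_inverse:
  assumes "\<alpha> \<in> Bij S" shows "\<And>x. x \<in> S \<Longrightarrow> inv_into S \<alpha> (\<alpha> x) = x"
  using assms by (simp add: Bij_def bij_betw_def)

text \<open>All germs of \<alpha> together form the compact open G-set: they are open by definition,
  injective under source by \<open>germ_unique\<close> and under range by injectivity of \<alpha>,
  and compact as a section over the compact unit space. Membership thus becomes a local test, and
  even the continuity and openness of \<alpha> are read off from the germs.\<close>

lemma full_groupI:
  assumes bij: "\<alpha> \<in> Bij (unit_space G)" and germs: "\<And>x. x \<in> unit_space G \<Longrightarrow> \<exists>g. src G g = x \<and> germ \<alpha> g"
  shows "\<alpha> \<in> carrier (topological_full_group G)"
proof -
  let ?U = "{g. germ \<alpha> g}"
  have inj: "inj_on \<alpha> (unit_space G)" and surj: "\<alpha> ` unit_space G = unit_space G"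
    and ext: "\<alpha> \<in> extensional (unit_space G)"
    using bij by (auto simp: Bij_def bij_betw_def)
  have srcU: "src G ` ?U = unit_space G"
    using germs src_unit germ_arrow by blast
  have injs: "inj_on (src G) ?U"
    using germ_unique[OF _ _ _ inj] by (auto intro: inj_onI)
  have injr: "inj_on (rng G) ?U"
  proof (rule inj_onI)
    fix g h assume gh: "g \<in> ?U" "h \<in> ?U" "rng G g = rng G h"
    then have "\<alpha> (src G g) = \<alpha> (src G h)" using germ_eval by simp
    then have "src G g = src G h"
      using inj_onD[OF inj] gh src_unit germ_arrow by blast
    then show "g = h" using inj_onD[OF injs] gh by blast
  qed
  have rngU: "rng G ` ?U = unit_space G"
  proof -
    have "rng G ` ?U = \<alpha> ` src G ` ?U" using germ_eval by (force simp: image_image)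
    then show ?thesis using srcU surj by simp
  qed
  have homeo: "homeomorphic_map (unit_top G) (unit_top G) \<alpha>"
  proof (rule bijective_open_imp_homeomorphic_map)
    show "continuous_map (unit_top G) (unit_top G) \<alpha>"
      unfolding continuous_map_def topspace_unit_top
    proof (intro conjI allI impI)
      fix V assume V: "openin (unit_top G) V"
      have "{x \<in> unit_space G. \<alpha> x \<in> V} = src G ` (?U \<inter> {g \<in> arrows G. rng G g \<in> V})"
      proof (intro equalityI subsetI)
        fix x assume x: "x \<in> {x \<in> unit_space G. \<alpha> x \<in> V}"
        then obtain g where "src G g = x" "germ \<alpha> g" using germs by blast
        then show "x \<in> src G ` (?U \<inter> {g \<in> arrows G. rng G g \<in> V})"
          using x germ_eval[of \<alpha> g] germ_arrow[of \<alpha> g] by auto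
      next
        fix x assume "x \<in> src G ` (?U \<inter> {g \<in> arrows G. rng G g \<in> V})"
        then obtain g where g: "germ \<alpha> g" "g \<in> arrows G" "rng G g \<in> V" "x = src G g" by blast
        then show "x \<in> {x \<in> unit_space G. \<alpha> x \<in> V}"
          using germ_eval[of \<alpha> g] src_unit by simp
      qed
      moreover have "openin (gtop G) (?U \<inter> {g \<in> arrows G. rng G g \<in> V})"
        using openin_germ openin_rng_preimage[OF V] by blast
      ultimately show "openin (unit_top G) {x \<in> unit_space G. \<alpha> x \<in> V}"
        using openin_src_image by simp
    qed (use surj in auto)
    show "open_map (unit_top G) (unit_top G) \<alpha>"
      unfolding open_map_def
    proof (intro allI impI)
      fix V assume V: "openin (unit_top G) V"
      have VX: "V \<subseteq> unit_space G" using openin_subset[OF V] topspace_unit_top by simp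
      have "\<alpha> ` V = rng G ` (?U \<inter> {g \<in> arrows G. src G g \<in> V})"
      proof (intro equalityI subsetI)
        fix y assume "y \<in> \<alpha> ` V"
        then obtain x where x: "x \<in> V" "y = \<alpha> x" by blast
        then obtain g where "src G g = x" "germ \<alpha> g" using germs VX by blast
        then show "y \<in> rng G ` (?U \<inter> {g \<in> arrows G. src G g \<in> V})"
          using x germ_eval[of \<alpha> g] germ_arrow[of \<alpha> g] by auto
      next
        fix y assume "y \<in> rng G ` (?U \<inter> {g \<in> arrows G. src G g \<in> V})"
        then obtain g where g: "germ \<alpha> g" "src G g \<in> V" "y = rng G g" by blast
        then show "y \<in> \<alpha> ` V"
          using germ_eval[of \<alpha> g] by (metis imageI)
      qed
      moreover have "openin (gtop G) (?U \<inter> {g \<in> arrows G. src G g \<in> V})"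
        using openin_germ openin_src_preimage[OF V] by blast
      ultimately show "openin (unit_top G) (\<alpha> ` V)"
        using openin_rng_image by simp
    qed
  qed (use inj surj in \<open>auto simp: topspace_unit_top\<close>)
  have "G_set G ?U"
    unfolding G_set_def using injr injs germ_arrow by blast
  moreover have "compactin (gtop G) ?U"
    using compactin_section[OF openin_germ injs] srcU compact_unit topspace_unit_top
    unfolding compact_space_def by simp
  moreover have "\<alpha> = G_set_map G ?U"
  proof (rule extensionalityI[OF ext])
    show "G_set_map G ?U \<in> extensional (unit_space G)"
      unfolding G_set_map_def srcU by simp
    fix x assume "x \<in> unit_space G"
    then obtain g where g: "src G g = x" "germ \<alpha> g" using germs by blast
    then have "inv_into ?U (src G) x = g" using injs by (auto intro: inv_into_f_eq)
    then show "\<alpha> x = G_set_map G ?U x"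
      using g \<open>x \<in> unit_space G\<close> germ_eval[of \<alpha> g] by (simp add: G_set_map_def srcU)
  qed
  ultimately show ?thesis
    unfolding topological_full_group_def homeo_group_def
    using bij homeo openin_germ srcU rngU topspace_unit_top by auto
qed

lemma full_group_record:
  "topological_full_group G = BijGroup (unit_space G)\<lparr>carrier := carrier (topological_full_group G)\<rparr>"
  by (simp add: topological_full_group_def homeo_group_def topspace_unit_top)

text \<open>Closure is checked one germ at a time: units, inverses and products of arrows are germs
  of the identity, the inverse map and the composite.\<close>

lemma full_group_subgroup: "subgroup (carrier (topological_full_group G)) (BijGroup (unit_space G))"
proof -
  interpret B: group "BijGroup (unit_space G)" by (rule group_BijGroup)
  have carr: "carrier (BijGroup (unit_space G)) = Bij (unit_space G)" by (simp add: BijGroup_def)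
  show ?thesis
  proof (rule B.subgroupI)
    show "carrier (topological_full_group G) \<subseteq> carrier (BijGroup (unit_space G))"
      using full_group_germ(1) carr by blast
    have "(\<lambda>x\<in>unit_space G. x) \<in> carrier (topological_full_group G)"
    proof (rule full_groupI)
      fix x assume x: "x \<in> unit_space G"
      have "germ (\<lambda>x\<in>unit_space G. x) x"
        using x openin_topspace[of "unit_top G"] by (intro germ_unit[of "unit_space G"]) (auto simp: topspace_unit_top)
      then show "\<exists>g. src G g = x \<and> germ (\<lambda>x\<in>unit_space G. x) g"
        using x by (intro exI[of _ x]) simp
    qed (rule id_Bij)
    then show "carrier (topological_full_group G) \<noteq> {}" by blast
  next
    fix \<alpha> assume \<alpha>: "\<alpha> \<in> carrier (topological_full_group G)"
    note bij = full_group_germ(1)[OF \<alpha>]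
    let ?\<beta> = "\<lambda>x\<in>unit_space G. inv_into (unit_space G) \<alpha> x"
    have "?\<beta> \<in> carrier (topological_full_group G)"
    proof (rule full_groupI)
      show "?\<beta> \<in> Bij (unit_space G)" by (rule restrict_inv_into_Bij[OF bij])
      fix x assume x: "x \<in> unit_space G"
      then obtain y where y: "y \<in> unit_space G" "x = \<alpha> y"
        using bij by (auto simp: Bij_def bij_betw_def)
      then obtain g where g: "src G g = y" "germ \<alpha> g" using full_group_germ(2)[OF \<alpha>] by blast
      have "\<And>z. z \<in> unit_space G \<Longrightarrow> \<alpha> z \<in> unit_space G"
        using Bij_imp_funcset[OF bij] by blast
      then have "germ ?\<beta> (ginv G g)"
        using Bij_inverse[OF bij] by (intro germ_inv[OF g(2)]) simp
      moreover have "src G (ginv G g) = x"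
        using g y germ_eval[OF g(2)] germ_arrow[OF g(2)] by (simp add: src_inv)
      ultimately show "\<exists>g. src G g = x \<and> germ ?\<beta> g" by blast
    qed
    then show "inv\<^bsub>BijGroup (unit_space G)\<^esub> \<alpha> \<in> carrier (topological_full_group G)"
      using inv_BijGroup[OF bij] by simp
  next
    fix \<alpha> \<beta> assume \<alpha>: "\<alpha> \<in> carrier (topological_full_group G)" and \<beta>: "\<beta> \<in> carrier (topological_full_group G)"
    note bij = full_group_germ(1)[OF \<alpha>] full_group_germ(1)[OF \<beta>]
    have "compose (unit_space G) \<alpha> \<beta> \<in> carrier (topological_full_group G)"
    proof (rule full_groupI)
      show "compose (unit_space G) \<alpha> \<beta> \<in> Bij (unit_space G)" by (rule compose_Bij[OF bij])
      fix x assume x: "x \<in> unit_space G"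
      obtain h where h: "src G h = x" "germ \<beta> h" using full_group_germ(2)[OF \<beta> x] by blast
      note ha = germ_arrow[OF h(2)]
      obtain g where g: "src G g = rng G h" "germ \<alpha> g"
        using full_group_germ(2)[OF \<alpha> rng_unit[OF ha]] by blast
      note ga = germ_arrow[OF g(2)]
      have "germ (compose (unit_space G) \<alpha> \<beta>) (gmult G g h)"
        by (rule germ_mult[OF g(2) h(2) g(1)]) (simp add: compose_def)
      moreover have "src G (gmult G g h) = x"
        using src_mult[OF composableI[OF ga ha g(1)]] h(1) by simp
      ultimately show "\<exists>g. src G g = x \<and> germ (compose (unit_space G) \<alpha> \<beta>) g" by blast
    qed
    then show "\<alpha> \<otimes>\<^bsub>BijGroup (unit_space G)\<^esub> \<beta> \<in> carrier (topological_full_group G)"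
      using bij by (simp add: BijGroup_def)
  qed
qed

lemma group_full_group: "group (topological_full_group G)"
  using subgroup.subgroup_is_group[OF full_group_subgroup group_BijGroup] full_group_record by simp

lemma full_group_mult:
  assumes "\<alpha> \<in> carrier (topological_full_group G)" "\<beta> \<in> carrier (topological_full_group G)" "x \<in> unit_space G"
  shows "(\<alpha> \<otimes>\<^bsub>topological_full_group G\<^esub> \<beta>) x = \<alpha> (\<beta> x)"
  using full_group_germ(1)[OF assms(1)] full_group_germ(1)[OF assms(2)] assms(3)
  by (simp add: topological_full_group_def homeo_group_def topspace_unit_top BijGroup_def compose_def)

lemma full_group_one: "\<one>\<^bsub>topological_full_group G\<^esub> = (\<lambda>x\<in>unit_space G. x)"
  by (simp add: topological_full_group_def homeo_group_def topspace_unit_top BijGroup_def)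

lemma full_group_closed: "\<alpha> \<in> carrier (topological_full_group G) \<Longrightarrow> x \<in> unit_space G \<Longrightarrow> \<alpha> x \<in> unit_space G"
  using full_group_germ(1) Bij_imp_funcset by blast

lemma full_group_eqI:
  assumes "\<alpha> \<in> carrier (topological_full_group G)" "\<beta> \<in> carrier (topological_full_group G)"
    "\<And>x. x \<in> unit_space G \<Longrightarrow> \<alpha> x = \<beta> x"
  shows "\<alpha> = \<beta>"
  using full_group_germ(1)[OF assms(1)] full_group_germ(1)[OF assms(2)] assms(3)
  by (auto simp: Bij_def intro: extensionalityI)

lemma full_group_homeo: "\<alpha> \<in> carrier (topological_full_group G) \<Longrightarrow> homeomorphic_map (unit_top G) (unit_top G) \<alpha>"
  by (simp add: topological_full_group_def homeo_group_def)

lemma full_group_germ_unique: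
  assumes "\<alpha> \<in> carrier (topological_full_group G)" "germ \<alpha> g" "germ \<alpha> h" "src G g = src G h"
  shows "g = h"
  using full_group_germ(1)[OF assms(1)] germ_unique[OF assms(2-4)] by (simp add: Bij_def bij_betw_def)

section \<open>Fresh orbit points, clopen supports and transpositions\<close>

lemma orbit_meets_open:
  assumes x: "x \<in> unit_space G" and V: "openin (unit_top G) V" "V \<noteq> {}" and F: "finite F"
  obtains g where "g \<in> arrows G" "src G g = x" "rng G g \<in> V" "rng G g \<notin> F"
proof -
  have VX: "V \<subseteq> unit_space G" using openin_subset[OF V(1)] topspace_unit_top by simp
  have "infinite V"
    using no_isolated_infinite[OF Hausdorff_unit _ V] not_isolated topspace_unit_top by simp
  then obtain y where y: "y \<in> V - F" using F by (metis finite_Diff2 finite.emptyI ex_in_conv)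
  have "closedin (unit_top G) (V \<inter> F)"
    using VX F topspace_unit_top by (intro closedin_Hausdorff_finite[OF Hausdorff_unit]) auto
  then have "openin (unit_top G) (V - V \<inter> F)" using V by blast
  then have "openin (unit_top G) (V - F)" by (simp add: Diff_Int)
  moreover have "y \<in> unit_top G closure_of orbit_of G x"
    using minimal x y VX unfolding minimal_groupoid_def by blast
  ultimately obtain z where "z \<in> orbit_of G x" "z \<in> V - F"
    using y unfolding in_closure_of by blast
  then show thesis using that unfolding orbit_of_def by blast
qed

text \<open>A point lies in the support exactly when the germ of \<alpha> there is not a unit. Units
  form a closed set of arrows, so the non-unit germs are open, and the source map is open.\<close>

lemma openin_support:
  assumes \<alpha>: "\<alpha> \<in> carrier (topological_full_group G)"
  shows "openin (unit_top G) (support (unit_top G) \<alpha>)"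
proof -
  have "support (unit_top G) \<alpha> = src G ` ({g. germ \<alpha> g} - unit_space G)"
  proof (intro equalityI subsetI)
    fix x assume x: "x \<in> support (unit_top G) \<alpha>"
    then have xX: "x \<in> unit_space G"
      by (simp add: support_def in_closure_of topspace_unit_top)
    then obtain g where g: "src G g = x" "germ \<alpha> g" using full_group_germ(2)[OF \<alpha>] by blast
    have "g \<notin> unit_space G"
    proof
      assume gu: "g \<in> unit_space G"
      obtain W where W: "openin (gtop G) W" "g \<in> W" "\<forall>u\<in>W. \<alpha> (src G u) = rng G u"
        using g(2) unfolding germ_def by blast
      have "openin (unit_top G) (W \<inter> unit_space G)"
        using W openin_unit_space by (auto simp: openin_unit_top)
      moreover have "x \<in> W \<inter> unit_space G" using W gu g by simp
      ultimately obtain y where y: "y \<in> moved (unit_top G) \<alpha>" "y \<in> W" "y \<in> unit_space G"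
        using x unfolding support_def in_closure_of by blast
      then have "\<alpha> y = y" using bspec[OF W(3) y(2)] by simp
      then show False using y by (simp add: moved_def)
    qed
    then show "x \<in> src G ` ({g. germ \<alpha> g} - unit_space G)" using g by blast
  next
    fix x assume "x \<in> src G ` ({g. germ \<alpha> g} - unit_space G)"
    then obtain g where g: "germ \<alpha> g" "g \<notin> unit_space G" "x = src G g" by blast
    have x: "x \<in> unit_space G" using g germ_arrow src_unit by blast
    show "x \<in> support (unit_top G) \<alpha>"
    proof (rule ccontr)
      assume "x \<notin> support (unit_top G) \<alpha>"
      then obtain N where N: "openin (unit_top G) N" "x \<in> N" "\<And>y. y \<in> N \<Longrightarrow> y \<notin> moved (unit_top G) \<alpha>"
        using x unfolding support_def in_closure_of topspace_unit_top by blast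
      have "N \<subseteq> unit_space G" using openin_subset[OF N(1)] topspace_unit_top by simp
      then have "germ \<alpha> x"
        using N(3) by (intro germ_unit[OF N(1,2)]) (auto simp: moved_def topspace_unit_top)
      then have "g = x"
        using full_group_germ_unique[OF \<alpha> g(1)] g(3) x by simp
      then show False using x g by simp
    qed
  qed
  moreover have "openin (gtop G) ({g. germ \<alpha> g} - unit_space G)"
    using openin_germ closedin_unit_space by blast
  ultimately show ?thesis using openin_src_image by simp
qed

text \<open>The map exchanges source and range of each arrow in a small bisection around
  \<open>g\<close> and fixes everything else. With source and range sets clopen and disjoint, it has
  a germ at every unit.\<close>

lemma transposition:
  assumes g: "g \<in> arrows G" and ne: "src G g \<noteq> rng G g"
    and A: "openin (unit_top G) A" "src G g \<in> A" "rng G g \<in> A"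
  obtains t where "t \<in> carrier (topological_full_group G)" "germ t g"
    "\<And>x. x \<in> unit_space G \<Longrightarrow> t (t x) = x" "\<And>x. x \<in> unit_space G \<Longrightarrow> x \<notin> A \<Longrightarrow> t x = x"
    "t (src G g) = rng G g" "t (rng G g) = src G g"
proof -
  \<comment> \<open>Disjoint neighbourhoods keep the source and range sets of the bisection apart,
    so the exchange is well defined.\<close>
  obtain P Q where PQ: "openin (unit_top G) P" "openin (unit_top G) Q" "src G g \<in> P" "rng G g \<in> Q" "P \<inter> Q = {}"
    using Hausdorff_unit ne src_unit[OF g] rng_unit[OF g]
    unfolding Hausdorff_space_def topspace_unit_top disjnt_def by metis
  let ?W = "{u \<in> arrows G. src G u \<in> A \<inter> P} \<inter> {u \<in> arrows G. rng G u \<in> A \<inter> Q}"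
  have "openin (gtop G) ?W"
    using A PQ by (intro openin_Int openin_src_preimage openin_rng_preimage)
  moreover have "g \<in> ?W" using g A PQ by simp
  ultimately obtain W where W: "openin (gtop G) W" "g \<in> W" "W \<subseteq> ?W" "inj_on (rng G) W" "inj_on (src G) W"
    by (rule open_bisection)
  obtain B where B: "openin (unit_top G) B" "closedin (unit_top G) B" "src G g \<in> B" "B \<subseteq> src G ` W"
    using clopen_unit_neighbourhood[OF openin_src_image[OF W(1)] imageI[OF W(2)]] .
  define U where "U = W \<inter> {u \<in> arrows G. src G u \<in> B}"
  have U: "openin (gtop G) U" unfolding U_def using W(1) openin_src_preimage[OF B(1)] by blast
  have gU: "g \<in> U" using W B g by (simp add: U_def)
  have Ua: "U \<subseteq> arrows G" by (auto simp: U_def)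
  have injs: "inj_on (src G) U" and injr: "inj_on (rng G) U"
    using W(4,5) by (auto simp: U_def intro: inj_on_subset)
  have srcU: "src G ` U = B" using B(4) W(3) by (auto simp: U_def)
  define R where "R = rng G ` U"
  have "src G u \<in> A \<inter> P" "rng G u \<in> A \<inter> Q" if "u \<in> U" for u
    using that W(3) by (auto simp: U_def)
  then have "B \<subseteq> A \<inter> P" "R \<subseteq> A \<inter> Q"
    unfolding R_def srcU[symmetric] by blast+
  then have BR: "B \<inter> R = {}" "B \<subseteq> A" "R \<subseteq> A"
    using PQ(5) by blast+
  have "compactin (gtop G) U"
    using srcU closedin_compact_space[OF compact_unit B(2)] by (intro compactin_section[OF U injs]) simp
  \<comment> \<open>Compactness of \<open>U\<close> makes its range set closed. As \<open>B\<close>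
    and \<open>R\<close> are both clopen, their complement is open, and there the germs of
    \<open>t\<close> are units.\<close>
  then have R: "openin (unit_top G) R" "closedin (unit_top G) R"
    unfolding R_def using openin_rng_image[OF U] image_compactin[OF _ continuous_rng]
      compactin_imp_closedin[OF Hausdorff_unit] by auto
  have BX: "B \<subseteq> unit_space G" and RX: "R \<subseteq> unit_space G"
    using openin_subset[OF B(1)] openin_subset[OF R(1)] by (auto simp: topspace_unit_top)
  define t where "t = (\<lambda>x\<in>unit_space G. if x \<in> B then rng G (inv_into U (src G) x)
      else if x \<in> R then src G (inv_into U (rng G) x) else x)"
  have t_src: "t (src G u) = rng G u" if u: "u \<in> U" for u
    using u injs srcU BX by (auto simp: t_def)
  have t_rng: "t (rng G u) = src G u" if u: "u \<in> U" for u
  proof -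
    have "rng G u \<in> R" using u by (simp add: R_def)
    then have "rng G u \<in> unit_space G" "rng G u \<notin> B" "rng G u \<in> R" using RX BR by auto
    then show ?thesis using u injr by (simp add: t_def)
  qed
  have t_fix: "t x = x" if "x \<in> unit_space G" "x \<notin> B" "x \<notin> R" for x
    using that by (simp add: t_def)
  have cases: "(\<exists>u\<in>U. x = src G u) \<or> (\<exists>u\<in>U. x = rng G u) \<or> (x \<notin> B \<and> x \<notin> R)" for x
    using srcU R_def by blast
  have "t x \<in> unit_space G \<and> t (t x) = x" if x: "x \<in> unit_space G" for x
    using cases[of x]
  proof (elim disjE bexE conjE)
    fix u assume u: "u \<in> U" "x = src G u"
    then show ?thesis using t_src t_rng rng_unit Ua by auto
  next
    fix u assume u: "u \<in> U" "x = rng G u"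
    then show ?thesis using t_src t_rng src_unit Ua by auto
  next
    assume "x \<notin> B" "x \<notin> R"
    then show ?thesis using t_fix x by simp
  qed
  then have t_unit: "t x \<in> unit_space G" and tt: "t (t x) = x" if "x \<in> unit_space G" for x
    using that by blast+
  have "bij_betw t (unit_space G) (unit_space G)"
    by (rule bij_betw_byWitness[where f' = t]) (use t_unit tt in auto)
  moreover have "t \<in> extensional (unit_space G)" by (simp add: t_def)
  ultimately have "t \<in> Bij (unit_space G)"
    by (simp add: Bij_def)
  moreover have "\<exists>h. src G h = x \<and> germ t h" if x: "x \<in> unit_space G" for x
    using cases[of x]
  proof (elim disjE bexE conjE)
    fix u assume "u \<in> U" "x = src G u"
    moreover have "germ t u" using \<open>u \<in> U\<close> U t_src unfolding germ_def by blast
    ultimately show ?thesis by blast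
  next
    fix u assume u: "u \<in> U" "x = rng G u"
    have ua: "u \<in> arrows G" using u Ua by blast
    have "t (src G h) = rng G h" if "h \<in> {h \<in> arrows G. ginv G h \<in> U}" for h
      using that t_rng[of "ginv G h"] by (simp add: rng_inv src_inv)
    moreover have "ginv G u \<in> {h \<in> arrows G. ginv G h \<in> U}"
      using u ua by (simp add: inv_inv inv_closed)
    ultimately have "germ t (ginv G u)"
      using openin_inv_preimage[OF U] unfolding germ_def by blast
    then show ?thesis using u ua by (intro exI[of _ "ginv G u"]) (simp add: src_inv)
  next
    assume "x \<notin> B" "x \<notin> R"
    moreover have "openin (unit_top G) (unit_space G - B - R)"
      using B R topspace_unit_top by (metis openin_diff openin_topspace)
    ultimately have "germ t x"
      using x t_fix by (intro germ_unit[of "unit_space G - B - R"]) auto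
    then show ?thesis using x by (intro exI[of _ x]) simp
  qed
  ultimately have "t \<in> carrier (topological_full_group G)" by (rule full_groupI)
  moreover have "germ t g" using gU U t_src unfolding germ_def by blast
  moreover have "t x = x" if "x \<in> unit_space G" "x \<notin> A" for x
    using that BR t_fix by blast
  ultimately show thesis
    using that tt t_src[OF gU] t_rng[OF gU] by blast
qed

end

section \<open>Subgroups containing the commutator subgroup\<close>

locale full_subgroup = minimal_cantor_groupoid G for G :: "('a, 'm) top_groupoid_scheme" +
  fixes \<Gamma> :: "('a \<Rightarrow> 'a) set"
  assumes subgroup: "subgroup \<Gamma> (topological_full_group G)"
    and commutators: "commutator_subgroup (topological_full_group G) \<subseteq> \<Gamma>"
begin

abbreviation F :: "('a \<Rightarrow> 'a) monoid" where
  "F \<equiv> topological_full_group G"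

abbreviation H :: "('a \<Rightarrow> 'a) monoid" where
  "H \<equiv> (topological_full_group G)\<lparr>carrier := \<Gamma>\<rparr>"

lemma \<Gamma>_full: "\<alpha> \<in> \<Gamma> \<Longrightarrow> \<alpha> \<in> carrier F"
  by (rule subsetD[OF subgroup.subset[OF subgroup]])

lemma mult_\<Gamma>: "\<alpha> \<in> \<Gamma> \<Longrightarrow> \<beta> \<in> \<Gamma> \<Longrightarrow> \<alpha> \<otimes>\<^bsub>F\<^esub> \<beta> \<in> \<Gamma>"
  by (rule subgroup.m_closed[OF subgroup])

lemma one_\<Gamma>: "\<one>\<^bsub>F\<^esub> \<in> \<Gamma>"
  by (rule subgroup.one_closed[OF subgroup])

lemma commutator_\<Gamma>: "a \<in> carrier F \<Longrightarrow> b \<in> carrier F \<Longrightarrow> commutator F a b \<in> \<Gamma>"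
  by (rule subsetD[OF commutators[unfolded commutator_subgroup_def derived_def]], rule generate.incl)
    (auto simp: commutator_def)

lemma involution_commutator:
  assumes a: "a \<in> carrier F" "\<And>x. x \<in> unit_space G \<Longrightarrow> a (a x) = x"
    and b: "b \<in> carrier F" "\<And>x. x \<in> unit_space G \<Longrightarrow> b (b x) = x"
    and x: "x \<in> unit_space G"
  shows "commutator F a b x = a (b (a (b x)))"
proof -
  interpret F: group F by (rule group_full_group)
  have inv: "inv\<^bsub>F\<^esub> t = t" if t: "t \<in> carrier F" "\<And>x. x \<in> unit_space G \<Longrightarrow> t (t x) = x" for t
    using t by (intro F.inv_equality full_group_eqI) (auto simp: full_group_mult full_group_one F.one_closed[unfolded full_group_one])
  have "inv\<^bsub>F\<^esub> a = a" "inv\<^bsub>F\<^esub> b = b"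
    using a b by (auto intro: inv)
  then show ?thesis
    unfolding commutator_def using a(1) b(1) x by (simp add: full_group_mult full_group_closed)
qed

text \<open>A transposition \<open>t\<close> along \<open>g\<close> may lie outside \<Gamma>, but
  its commutator with a second transposition \<open>s\<close> does not. If \<open>s\<close> takes
  the source of \<open>g\<close> to a third orbit point, outside the set where \<open>t\<close>
  acts, the commutator agrees with \<open>t\<close> near that source.\<close>

lemma germ_in_\<Gamma>_nonisotropic:
  assumes g: "g \<in> arrows G" and ne: "src G g \<noteq> rng G g"
  obtains \<alpha> where "\<alpha> \<in> \<Gamma>" "germ \<alpha> g"
proof -
  let ?x = "src G g"
  have x: "?x \<in> unit_space G" by (rule src_unit[OF g])
  have "openin (unit_top G) (unit_space G)" "unit_space G \<noteq> {}"
    using openin_topspace[of "unit_top G"] topspace_unit_top x by auto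
  then obtain h where h: "h \<in> arrows G" "src G h = ?x" "rng G h \<notin> {?x, rng G g}"
    using orbit_meets_open[OF x, of "unit_space G" "{?x, rng G g}"] by blast
  have zu: "rng G h \<in> unit_space G" by (rule rng_unit[OF h(1)])
  have op: "openin (unit_top G) (unit_space G - {rng G h})"
    using open_in_Hausdorff_delete[OF Hausdorff_unit openin_topspace] topspace_unit_top by simp
  have "?x \<in> unit_space G - {rng G h}" and "rng G g \<in> unit_space G - {rng G h}"
    using h x rng_unit[OF g] by auto
  note nbs = clopen_unit_neighbourhood[OF op this(1)] clopen_unit_neighbourhood[OF op this(2)]
  obtain A1 where A1: "openin (unit_top G) A1" "closedin (unit_top G) A1" "?x \<in> A1"
    "A1 \<subseteq> unit_space G - {rng G h}" by (rule nbs(1))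
  obtain A2 where A2: "openin (unit_top G) A2" "closedin (unit_top G) A2" "rng G g \<in> A2"
    "A2 \<subseteq> unit_space G - {rng G h}" by (rule nbs(2))
  \<comment> \<open>Openness of \<open>A\<close> allows \<open>t\<close> to be confined to it;
    closedness makes its complement a neighbourhood of the third point.\<close>
  define A where "A = A1 \<union> A2"
  have A: "openin (unit_top G) A" "closedin (unit_top G) A" "?x \<in> A" "rng G g \<in> A" "rng G h \<notin> A"
    using A1 A2 by (auto simp: A_def)
  obtain t where t: "t \<in> carrier F" "germ t g" "\<And>y. y \<in> unit_space G \<Longrightarrow> t (t y) = y"
    "\<And>y. y \<in> unit_space G \<Longrightarrow> y \<notin> A \<Longrightarrow> t y = y"
    using transposition[OF g ne A(1,3,4)] by metis
  have hne: "src G h \<noteq> rng G h" using h by auto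
  obtain s where s: "s \<in> carrier F" "\<And>y. y \<in> unit_space G \<Longrightarrow> s (s y) = y" "s ?x = rng G h"
    using transposition[OF h(1) hne \<open>openin (unit_top G) (unit_space G)\<close>] h x zu by metis
  \<comment> \<open>On \<open>?N\<close> the map \<open>s\<close> leads out of \<open>A\<close>,
    where \<open>t\<close> is the identity, so \<open>t (s (t (s y)))\<close> reduces to
    \<open>t y\<close>.\<close>
  let ?N = "{y \<in> unit_space G. s y \<in> unit_space G - A}"
  have "openin (unit_top G) (unit_space G - A)"
    using A topspace_unit_top by (metis openin_closedin_eq openin_diff openin_topspace)
  from openin_continuous_map_preimage[OF homeomorphic_imp_continuous_map[OF full_group_homeo[OF s(1)]] this]
  have "openin (unit_top G) ?N" by (simp add: topspace_unit_top)
  moreover have "?x \<in> ?N" using x s zu A by simp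
  moreover have "t y = commutator F t s y" if y: "y \<in> ?N" for y
    using y t(4)[of "s y"] s(2)[of y] by (simp add: involution_commutator[OF t(1,3) s(1,2)])
  ultimately have "germ (commutator F t s) g"
    by (rule germ_cong[OF t(2)])
  then show thesis using that commutator_\<Gamma>[OF t(1) s(1)] by blast
qed

text \<open>Factoring \<open>g\<close> through a third orbit point, as
  \<open>(g h\<inverse>) h\<close>, gives two arrows whose sources and ranges differ, even if
  \<open>g\<close> is isotropic.\<close>

lemma germ_in_\<Gamma>:
  assumes g: "g \<in> arrows G"
  obtains \<alpha> where "\<alpha> \<in> \<Gamma>" "germ \<alpha> g"
proof -
  let ?x = "src G g"
  have x: "?x \<in> unit_space G" by (rule src_unit[OF g])
  have "openin (unit_top G) (unit_space G)" "unit_space G \<noteq> {}"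
    using openin_topspace[of "unit_top G"] topspace_unit_top x by auto
  then obtain h where h: "h \<in> arrows G" "src G h = ?x" "rng G h \<notin> {?x, rng G g}"
    using orbit_meets_open[OF x, of "unit_space G" "{?x, rng G g}"] by blast
  let ?k = "gmult G g (ginv G h)"
  have comp: "(g, ginv G h) \<in> composable G"
    using g h by (intro composableI inv_closed) (auto simp: rng_inv)
  have k: "?k \<in> arrows G" "src G ?k = rng G h" "rng G ?k = rng G g"
    using mult_closed[OF comp] src_mult[OF comp] rng_mult[OF comp] h src_inv by auto
  obtain \<alpha> where \<alpha>: "\<alpha> \<in> \<Gamma>" "germ \<alpha> ?k"
    using germ_in_\<Gamma>_nonisotropic[OF k(1)] k h by auto
  have hne: "src G h \<noteq> rng G h" using h by auto
  obtain \<beta> where \<beta>: "\<beta> \<in> \<Gamma>" "germ \<beta> h"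
    using germ_in_\<Gamma>_nonisotropic[OF h(1) hne] .
  have "germ (\<alpha> \<otimes>\<^bsub>F\<^esub> \<beta>) (gmult G ?k h)"
    using \<alpha> \<beta> k by (intro germ_mult[OF \<alpha>(2) \<beta>(2)]) (auto intro: full_group_mult \<Gamma>_full)
  moreover have "gmult G ?k h = g" using g h by (intro mult_inv_cancel_right) auto
  ultimately show thesis using that mult_\<Gamma>[OF \<alpha>(1) \<beta>(1)] by simp
qed

lemma moving_element:
  assumes V: "openin (unit_top G) V" and x: "x \<in> V"
  shows "\<exists>f\<in>\<Gamma>. support (unit_top G) f \<subseteq> V \<and> (f ^^ 12) x \<noteq> x"
proof -
  obtain A where A: "openin (unit_top G) A" "closedin (unit_top G) A" "x \<in> A" "A \<subseteq> V"
    using clopen_unit_neighbourhood[OF V x] .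
  have AX: "A \<subseteq> unit_space G" using openin_subset[OF A(1)] topspace_unit_top by simp
  have xX: "x \<in> unit_space G" using AX A(3) by blast
  have A_ne: "A \<noteq> {}" using A(3) by blast
  obtain g1 where g1: "g1 \<in> arrows G" "src G g1 = x" "rng G g1 \<in> A" "rng G g1 \<notin> {x}"
    using orbit_meets_open[OF xX A(1) A_ne, of "{x}"] by blast
  define x1 where "x1 = rng G g1"
  obtain g2 where g2: "g2 \<in> arrows G" "src G g2 = x" "rng G g2 \<in> A" "rng G g2 \<notin> {x, x1}"
    using orbit_meets_open[OF xX A(1) A_ne, of "{x, x1}"] by blast
  define x2 where "x2 = rng G g2"
  obtain g3 where g3: "g3 \<in> arrows G" "src G g3 = x" "rng G g3 \<in> A" "rng G g3 \<notin> {x, x1, x2}"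
    using orbit_meets_open[OF xX A(1) A_ne, of "{x, x1, x2}"] by blast
  define x3 where "x3 = rng G g3"
  obtain g4 where g4: "g4 \<in> arrows G" "src G g4 = x" "rng G g4 \<in> A" "rng G g4 \<notin> {x, x1, x2, x3}"
    using orbit_meets_open[OF xX A(1) A_ne, of "{x, x1, x2, x3}"] by blast
  define x4 where "x4 = rng G g4"
  have ne: "x \<noteq> x1" "x \<noteq> x2" "x \<noteq> x3" "x \<noteq> x4" "x1 \<noteq> x2" "x1 \<noteq> x3" "x1 \<noteq> x4"
    "x2 \<noteq> x3" "x2 \<noteq> x4" "x3 \<noteq> x4"
    using g1 g2 g3 g4 by (auto simp: x1_def x2_def x3_def x4_def)
  have inA: "x1 \<in> A" "x2 \<in> A" "x3 \<in> A" "x4 \<in> A"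
    using g1 g2 g3 g4 by (auto simp: x1_def x2_def x3_def x4_def)
  then have inX: "x1 \<in> unit_space G" "x2 \<in> unit_space G" "x3 \<in> unit_space G" "x4 \<in> unit_space G"
    using AX by auto
  \<comment> \<open>In each use \<open>E\<close> holds the other three orbit points; deleting them
    from \<open>A\<close> makes the transposition fix them.\<close>
  have transp: "\<exists>t\<in>carrier F. (\<forall>y\<in>unit_space G. t (t y) = y) \<and> t x = z \<and> t z = x \<and>
      (\<forall>y\<in>unit_space G. y \<notin> A - E \<longrightarrow> t y = y)"
    if g: "g \<in> arrows G" "src G g = x" "rng G g = z" "z \<in> A" "z \<noteq> x"
      and E: "finite E" "x \<notin> E" "z \<notin> E" for g z E
  proof -
    have "closedin (unit_top G) (A \<inter> E)"
      using AX E topspace_unit_top by (intro closedin_Hausdorff_finite[OF Hausdorff_unit]) auto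
    then have "openin (unit_top G) (A - A \<inter> E)" using A(1) by blast
    then have op: "openin (unit_top G) (A - E)" by (simp add: Diff_Int)
    show ?thesis
      using transposition[OF g(1) _ op] g E A(3) by (metis DiffI)
  qed
  obtain t1 where t1: "t1 \<in> carrier F" "\<forall>y\<in>unit_space G. t1 (t1 y) = y" "t1 x = x1" "t1 x1 = x"
    "\<forall>y\<in>unit_space G. y \<notin> A - {x2, x3, x4} \<longrightarrow> t1 y = y"
    using transp[of g1 x1 "{x2, x3, x4}"] g1 ne inA x1_def by auto
  obtain t2 where t2: "t2 \<in> carrier F" "\<forall>y\<in>unit_space G. t2 (t2 y) = y" "t2 x = x2" "t2 x2 = x"
    "\<forall>y\<in>unit_space G. y \<notin> A - {x1, x3, x4} \<longrightarrow> t2 y = y"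
    using transp[of g2 x2 "{x1, x3, x4}"] g2 ne inA x2_def by auto
  obtain t3 where t3: "t3 \<in> carrier F" "\<forall>y\<in>unit_space G. t3 (t3 y) = y" "t3 x = x3" "t3 x3 = x"
    "\<forall>y\<in>unit_space G. y \<notin> A - {x1, x2, x4} \<longrightarrow> t3 y = y"
    using transp[of g3 x3 "{x1, x2, x4}"] g3 ne inA x3_def by auto
  obtain t4 where t4: "t4 \<in> carrier F" "\<forall>y\<in>unit_space G. t4 (t4 y) = y" "t4 x = x4" "t4 x4 = x"
    "\<forall>y\<in>unit_space G. y \<notin> A - {x1, x2, x3} \<longrightarrow> t4 y = y"
    using transp[of g4 x4 "{x1, x2, x3}"] g4 ne inA x4_def by auto
  \<comment> \<open>With \<open>ti\<close> acting as \<open>(0 i)\<close>, \<open>[t1, t2] [t3, t4] = (0 1 2) (0 3 4) = (0 3 4 1 2)\<close>.\<close>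
  define c d where "c = commutator F t1 t2" and "d = commutator F t3 t4"
  have cd: "c \<in> \<Gamma>" "d \<in> \<Gamma>" using t1(1) t2(1) t3(1) t4(1) by (auto simp: c_def d_def commutator_\<Gamma>)
  define f where "f = c \<otimes>\<^bsub>F\<^esub> d"
  have f\<Gamma>: "f \<in> \<Gamma>" using mult_\<Gamma>[OF cd] by (simp add: f_def)
  have c: "c y = t1 (t2 (t1 (t2 y)))" if "y \<in> unit_space G" for y
    using involution_commutator[OF t1(1) _ t2(1)] t1(2) t2(2) that by (simp add: c_def)
  have d: "d y = t3 (t4 (t3 (t4 y)))" if "y \<in> unit_space G" for y
    using involution_commutator[OF t3(1) _ t4(1)] t3(2) t4(2) that by (simp add: d_def)
  have f: "f y = c (d y)" if "y \<in> unit_space G" for y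
    unfolding f_def using that cd by (intro full_group_mult \<Gamma>_full)
  have fixes1: "t1 x2 = x2" "t1 x3 = x3" "t1 x4 = x4" using t1(5) inX by auto
  have fixes2: "t2 x1 = x1" "t2 x3 = x3" "t2 x4 = x4" using t2(5) inX by auto
  have fixes3: "t3 x1 = x1" "t3 x2 = x2" "t3 x4 = x4" using t3(5) inX by auto
  have fixes4: "t4 x1 = x1" "t4 x2 = x2" "t4 x3 = x3" using t4(5) inX by auto
  note vals = c d f xX inX t1(3,4) t2(3,4) t3(3,4) t4(3,4) fixes1 fixes2 fixes3 fixes4
  have cyc: "f x = x3" "f x3 = x4" "f x4 = x1" "f x1 = x2" "f x2 = x"
    by (simp_all add: vals)
  \<comment> \<open>Since 12 is 2 modulo 5, this is two steps along the cycle: \<open>x\<close> to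
    \<open>x3\<close> to \<open>x4\<close>.\<close>
  have "(f ^^ 12) x = x4"
    by (simp add: eval_nat_numeral cyc)
  then have "(f ^^ 12) x \<noteq> x" using ne by simp
  moreover have "support (unit_top G) f \<subseteq> V"
  proof -
    \<comment> \<open>Because \<open>A\<close> is closed, fixing all points outside it bounds the
      whole support, not only the moved set.\<close>
    have "f y = y" if "y \<in> unit_space G" "y \<notin> A" for y
      using that t1(5) t2(5) t3(5) t4(5) by (simp add: c d f)
    then have "moved (unit_top G) f \<subseteq> A"
      by (auto simp: moved_def topspace_unit_top)
    then show ?thesis
      unfolding support_def using closure_of_minimal[OF _ A(2)] A(4) by blast
  qed
  ultimately show ?thesis using f\<Gamma> by blast
qed

lemma rubin_action: "rubin_action H (unit_top G)"
proof -
  have "group H"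
    using subgroup.subgroup_is_group[OF subgroup group_full_group] .
  then show ?thesis
  proof (intro rubin_action.intro rubin_action_axioms.intro)
    fix f assume "f \<in> carrier H" "\<And>x. x \<in> topspace (unit_top G) \<Longrightarrow> f x = x"
    then show "f = \<one>\<^bsub>H\<^esub>"
      using full_group_eqI[of f "\<one>\<^bsub>F\<^esub>"] \<Gamma>_full one_\<Gamma>
      by (auto simp: topspace_unit_top full_group_one)
  next
    fix V x assume "openin (unit_top G) V" "x \<in> V"
    then show "\<exists>g\<in>carrier H. support (unit_top G) g \<subseteq> V \<and> (g ^^ 12) x \<noteq> x"
      using moving_element by simp
  qed (use Hausdorff_unit compact_unit full_group_homeo full_group_mult full_group_one \<Gamma>_full
      openin_support in \<open>auto simp: topspace_unit_top\<close>)
qed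

end

section \<open>Extending a spatial isomorphism to arrows\<close>

locale spatial_iso =
  A: full_subgroup G1 \<Gamma>1 + B: full_subgroup G2 \<Gamma>2
  for G1 :: "('a, 'm) top_groupoid_scheme" and \<Gamma>1
    and G2 :: "('b, 'n) top_groupoid_scheme" and \<Gamma>2 +
  fixes \<Phi> :: "('a \<Rightarrow> 'a) \<Rightarrow> 'b \<Rightarrow> 'b" and \<phi> :: "'a \<Rightarrow> 'b"
  assumes iso: "\<Phi> \<in> iso A.H B.H"
    and homeo: "homeomorphic_map (unit_top G1) (unit_top G2) \<phi>"
    and equivariant: "\<lbrakk>\<alpha> \<in> \<Gamma>1; x \<in> unit_space G1\<rbrakk> \<Longrightarrow> \<phi> (\<alpha> x) = \<Phi> \<alpha> (\<phi> x)"
begin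

lemma \<Phi>_closed: "\<alpha> \<in> \<Gamma>1 \<Longrightarrow> \<Phi> \<alpha> \<in> \<Gamma>2"
  and \<Phi>_mult: "\<alpha> \<in> \<Gamma>1 \<Longrightarrow> \<beta> \<in> \<Gamma>1 \<Longrightarrow> \<Phi> (\<alpha> \<otimes>\<^bsub>A.F\<^esub> \<beta>) = \<Phi> \<alpha> \<otimes>\<^bsub>B.F\<^esub> \<Phi> \<beta>"
  using iso by (auto simp: iso_def hom_def)

lemma \<phi>_image: "\<phi> ` unit_space G1 = unit_space G2"
  using homeomorphic_imp_surjective_map[OF homeo]
  by (simp add: A.topspace_unit_top B.topspace_unit_top)

lemma \<phi>_inj: "inj_on \<phi> (unit_space G1)"
  using homeomorphic_imp_injective_map[OF homeo] by (simp add: A.topspace_unit_top)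

lemma \<phi>_unit: "x \<in> unit_space G1 \<Longrightarrow> \<phi> x \<in> unit_space G2"
  using \<phi>_image by blast

text \<open>The graph of the arrow map, sending the germ of \<alpha> at a unit to the germ of
  \<open>\<Phi> \<alpha>\<close> at its image under \<phi>. It starts as a relation because
  independence of the choice of \<alpha> needs proof.\<close>

definition rel :: "'a \<Rightarrow> 'b \<Rightarrow> bool" where
  "rel g h \<longleftrightarrow> (\<exists>\<alpha>\<in>\<Gamma>1. A.germ \<alpha> g \<and> B.germ (\<Phi> \<alpha>) h \<and> src G2 h = \<phi> (src G1 g))"

definition arrow_map :: "'a \<Rightarrow> 'b" where
  "arrow_map g = (THE h. rel g h)"

lemma rel_arrows: "rel g h \<Longrightarrow> g \<in> arrows G1" "rel g h \<Longrightarrow> h \<in> arrows G2"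
  by (auto simp: rel_def dest: A.germ_arrow B.germ_arrow)

lemma rel_src: "rel g h \<Longrightarrow> src G2 h = \<phi> (src G1 g)"
  unfolding rel_def by blast

lemma rel_rng:
  assumes "rel g h" shows "rng G2 h = \<phi> (rng G1 g)"
proof -
  obtain \<alpha> where \<alpha>: "\<alpha> \<in> \<Gamma>1" "A.germ \<alpha> g" "B.germ (\<Phi> \<alpha>) h" "src G2 h = \<phi> (src G1 g)"
    using assms unfolding rel_def by blast
  have "rng G2 h = \<Phi> \<alpha> (\<phi> (src G1 g))" using B.germ_eval[OF \<alpha>(3)] \<alpha>(4) by simp
  also have "\<dots> = \<phi> (\<alpha> (src G1 g))"
    using equivariant[OF \<alpha>(1)] A.src_unit[OF A.germ_arrow[OF \<alpha>(2)]] by simp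
  finally show ?thesis using A.germ_eval[OF \<alpha>(2)] by simp
qed

lemma rel_total:
  assumes g: "g \<in> arrows G1"
  obtains h where "rel g h"
proof -
  obtain \<alpha> where \<alpha>: "\<alpha> \<in> \<Gamma>1" "A.germ \<alpha> g" using A.germ_in_\<Gamma>[OF g] .
  then obtain h where "src G2 h = \<phi> (src G1 g)" "B.germ (\<Phi> \<alpha>) h"
    using B.full_group_germ(2)[OF B.\<Gamma>_full[OF \<Phi>_closed]] \<phi>_unit[OF A.src_unit[OF g]] by blast
  then have "rel g h" unfolding rel_def using \<alpha>(2) by (intro bexI[OF _ \<alpha>(1)] conjI)
  then show thesis by (rule that)
qed

text \<open>Two elements with the common germ \<open>g\<close> agree near its source. By
  equivariance their images under \<Phi> agree on the open \<phi>-image of that neighbourhood, so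
  they share a germ there.\<close>

lemma rel_unique:
  assumes "rel g h" "rel g k" shows "h = k"
proof -
  obtain \<alpha> where \<alpha>: "\<alpha> \<in> \<Gamma>1" "A.germ \<alpha> g" "B.germ (\<Phi> \<alpha>) h" "src G2 h = \<phi> (src G1 g)"
    using assms(1) unfolding rel_def by blast
  obtain \<beta> where \<beta>: "\<beta> \<in> \<Gamma>1" "A.germ \<beta> g" "B.germ (\<Phi> \<beta>) k" "src G2 k = \<phi> (src G1 g)"
    using assms(2) unfolding rel_def by blast
  obtain U where U: "openin (gtop G1) U" "g \<in> U" "\<forall>u\<in>U. \<alpha> (src G1 u) = rng G1 u"
    using \<alpha>(2) unfolding A.germ_def by blast
  obtain V where V: "openin (gtop G1) V" "g \<in> V" "\<forall>u\<in>V. \<beta> (src G1 u) = rng G1 u"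
    using \<beta>(2) unfolding A.germ_def by blast
  let ?N = "src G1 ` (U \<inter> V)"
  have N: "openin (unit_top G1) ?N" using A.openin_src_image U V by blast
  have NX: "?N \<subseteq> unit_space G1" using openin_subset[OF N] A.topspace_unit_top by simp
  have eq: "\<alpha> x = \<beta> x" if "x \<in> ?N" for x using that U V by auto
  have "openin (unit_top G2) (\<phi> ` ?N)"
    using homeomorphic_imp_open_map[OF homeo] N unfolding open_map_def by blast
  moreover have "src G2 h \<in> \<phi> ` ?N" using \<alpha>(4) U V by auto
  moreover have "\<Phi> \<alpha> y = \<Phi> \<beta> y" if y: "y \<in> \<phi> ` ?N" for y
  proof -
    obtain x where x: "y = \<phi> x" "x \<in> ?N" using y by (rule imageE)
    then have "x \<in> unit_space G1" using NX by blast
    then show ?thesis using equivariant[OF \<alpha>(1), of x] equivariant[OF \<beta>(1), of x] eq[OF x(2)] x(1) by simp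
  qed
  ultimately have "B.germ (\<Phi> \<beta>) h" by (rule B.germ_cong[OF \<alpha>(3)])
  then show ?thesis
    using B.full_group_germ_unique[OF B.\<Gamma>_full[OF \<Phi>_closed[OF \<beta>(1)]] _ \<beta>(3)] \<alpha>(4) \<beta>(4) by simp
qed

lemma rel_arrow_map: assumes "g \<in> arrows G1" shows "rel g (arrow_map g)"
proof -
  obtain h where "rel g h" using rel_total[OF assms] .
  then show ?thesis
    unfolding arrow_map_def by (rule theI) (rule rel_unique[OF _ \<open>rel g h\<close>])
qed

lemma arrow_map_eq: "rel g h \<Longrightarrow> arrow_map g = h"
  by (rule rel_unique[OF rel_arrow_map]) (auto dest: rel_arrows)

text \<open>A unit is a germ of the identity. Hence the arrow map extends \<phi>, which
  compatibility with source and range comes down to.\<close>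

lemma rel_unit:
  assumes x: "x \<in> unit_space G1" shows "rel x (\<phi> x)"
proof -
  have "\<Phi> \<one>\<^bsub>A.H\<^esub> = \<one>\<^bsub>B.H\<^esub>"
    by (rule hom_one[OF iso_imp_homomorphism[OF iso]
          subgroup.subgroup_is_group[OF A.subgroup A.group_full_group]
          subgroup.subgroup_is_group[OF B.subgroup B.group_full_group]])
  then have one: "\<Phi> \<one>\<^bsub>A.F\<^esub> = \<one>\<^bsub>B.F\<^esub>" by simp
  have "A.germ \<one>\<^bsub>A.F\<^esub> x"
    using x openin_topspace[of "unit_top G1"]
    by (intro A.germ_unit[of "unit_space G1"]) (auto simp: A.topspace_unit_top A.full_group_one)
  moreover have "B.germ \<one>\<^bsub>B.F\<^esub> (\<phi> x)"
    using \<phi>_unit[OF x] openin_topspace[of "unit_top G2"]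
    by (intro B.germ_unit[of "unit_space G2"]) (auto simp: B.topspace_unit_top B.full_group_one)
  ultimately show ?thesis
    unfolding rel_def using one x \<phi>_unit[OF x] by (intro bexI[OF _ A.one_\<Gamma>]) simp
qed

lemma rel_mult:
  assumes g: "rel g h" "rel g' h'" and comp: "src G1 g = rng G1 g'"
  shows "rel (gmult G1 g g') (gmult G2 h h')"
proof -
  obtain \<alpha> where \<alpha>: "\<alpha> \<in> \<Gamma>1" "A.germ \<alpha> g" "B.germ (\<Phi> \<alpha>) h"
    using g(1) unfolding rel_def by blast
  obtain \<beta> where \<beta>: "\<beta> \<in> \<Gamma>1" "A.germ \<beta> g'" "B.germ (\<Phi> \<beta>) h'"
    using g(2) unfolding rel_def by blast
  have comp': "src G2 h = rng G2 h'" using rel_src[OF g(1)] rel_rng[OF g(2)] comp by simp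
  have "A.germ (\<alpha> \<otimes>\<^bsub>A.F\<^esub> \<beta>) (gmult G1 g g')"
    using \<alpha>(1) \<beta>(1) by (intro A.germ_mult[OF \<alpha>(2) \<beta>(2) comp] A.full_group_mult A.\<Gamma>_full)
  moreover have "B.germ (\<Phi> (\<alpha> \<otimes>\<^bsub>A.F\<^esub> \<beta>)) (gmult G2 h h')"
    using \<alpha>(1) \<beta>(1) unfolding \<Phi>_mult[OF \<alpha>(1) \<beta>(1)]
    by (intro B.germ_mult[OF \<alpha>(3) \<beta>(3) comp'] B.full_group_mult B.\<Gamma>_full \<Phi>_closed)
  moreover have "src G2 (gmult G2 h h') = \<phi> (src G1 (gmult G1 g g'))"
    using A.src_mult[OF A.composableI[OF rel_arrows(1)[OF g(1)] rel_arrows(1)[OF g(2)] comp]]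
      B.src_mult[OF B.composableI[OF rel_arrows(2)[OF g(1)] rel_arrows(2)[OF g(2)] comp']]
      rel_src[OF g(2)] by simp
  ultimately show ?thesis
    unfolding rel_def by (intro bexI[OF _ A.mult_\<Gamma>[OF \<alpha>(1) \<beta>(1)]] conjI)
qed

lemma groupoid_hom_arrow_map: "groupoid_hom G1 G2 arrow_map"
  unfolding groupoid_hom_def
proof (intro conjI ballI)
  show "arrow_map \<in> arrows G1 \<rightarrow> arrows G2"
    by (intro funcsetI rel_arrows(2)[OF rel_arrow_map])
  fix g assume g: "g \<in> arrows G1"
  show "arrow_map (src G1 g) = src G2 (arrow_map g)"
    using arrow_map_eq[OF rel_unit[OF A.src_unit[OF g]]] rel_src[OF rel_arrow_map[OF g]] by simp
  show "arrow_map (rng G1 g) = rng G2 (arrow_map g)"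
    using arrow_map_eq[OF rel_unit[OF A.rng_unit[OF g]]] rel_rng[OF rel_arrow_map[OF g]] by simp
next
  fix p assume "p \<in> composable G1"
  then obtain g h where "p = (g, h)" "g \<in> arrows G1" "h \<in> arrows G1" "src G1 g = rng G1 h"
    unfolding composable_def by blast
  then show "case p of (g, h) \<Rightarrow> arrow_map (gmult G1 g h) = gmult G2 (arrow_map g) (arrow_map h)"
    using arrow_map_eq[OF rel_mult[OF rel_arrow_map rel_arrow_map]] by simp
qed

text \<open>A single \<alpha> serves all arrows near \<open>g\<close>: if \<open>u\<close> is a germ
  of \<alpha> and the \<phi>-image of its source is the source of a germ \<open>h\<close> of
  \<open>\<Phi> \<alpha>\<close> in \<open>Q\<close>, then \<open>h\<close> is the image of
  \<open>u\<close>.\<close>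

lemma continuous_arrow_map: "continuous_map (gtop G1) (gtop G2) arrow_map"
  unfolding continuous_map_def A.topspace_gtop B.topspace_gtop
proof (intro conjI allI impI)
  show "arrow_map \<in> arrows G1 \<rightarrow> arrows G2"
    by (intro funcsetI rel_arrows(2)[OF rel_arrow_map])
  fix Q assume Q: "openin (gtop G2) Q"
  show "openin (gtop G1) {g \<in> arrows G1. arrow_map g \<in> Q}"
  proof (subst openin_subopen, intro ballI)
    fix g assume "g \<in> {g \<in> arrows G1. arrow_map g \<in> Q}"
    then have g: "g \<in> arrows G1" "arrow_map g \<in> Q" by auto
    obtain \<alpha> where \<alpha>: "\<alpha> \<in> \<Gamma>1" "A.germ \<alpha> g" "B.germ (\<Phi> \<alpha>) (arrow_map g)"
      "src G2 (arrow_map g) = \<phi> (src G1 g)"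
      using rel_arrow_map[OF g(1)] unfolding rel_def by blast
    let ?W = "Q \<inter> {h. B.germ (\<Phi> \<alpha>) h}"
    let ?S = "{x \<in> unit_space G1. \<phi> x \<in> src G2 ` ?W}"
    let ?N = "{u. A.germ \<alpha> u} \<inter> {u \<in> arrows G1. src G1 u \<in> ?S}"
    have "openin (gtop G2) ?W" using Q B.openin_germ by blast
    from openin_continuous_map_preimage[OF homeomorphic_imp_continuous_map[OF homeo] B.openin_src_image[OF this]]
    have "openin (unit_top G1) ?S" by (simp add: A.topspace_unit_top)
    then have "openin (gtop G1) ?N"
      using A.openin_germ A.openin_src_preimage by blast
    moreover have "src G2 (arrow_map g) \<in> src G2 ` ?W" using \<alpha>(3) g(2) by blast
    then have "g \<in> ?N" using g \<alpha> A.src_unit by simp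
    moreover have "?N \<subseteq> {g \<in> arrows G1. arrow_map g \<in> Q}"
    proof
      fix u assume u: "u \<in> ?N"
      then obtain h where h: "h \<in> Q" "B.germ (\<Phi> \<alpha>) h" "src G2 h = \<phi> (src G1 u)" by auto
      have "rel u h" unfolding rel_def using u h by (intro bexI[OF _ \<alpha>(1)]) simp
      then show "u \<in> {g \<in> arrows G1. arrow_map g \<in> Q}" using u h(1) arrow_map_eq by simp
    qed
    ultimately show "\<exists>T. openin (gtop G1) T \<and> g \<in> T \<and> T \<subseteq> {g \<in> arrows G1. arrow_map g \<in> Q}"
      by blast
  qed
qed

lemma inverse_spatial_iso:
  "spatial_iso G2 \<Gamma>2 G1 \<Gamma>1 (inv_into \<Gamma>1 \<Phi>) (inv_into (unit_space G1) \<phi>)"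
proof unfold_locales
  have grp: "group A.H"
    by (rule subgroup.subgroup_is_group[OF A.subgroup A.group_full_group])
  show "inv_into \<Gamma>1 \<Phi> \<in> iso B.H A.H"
    using group.iso_set_sym[OF grp iso] by simp
  obtain \<psi> where \<psi>: "homeomorphic_maps (unit_top G1) (unit_top G2) \<phi> \<psi>"
    using homeo homeomorphic_map_maps by blast
  \<comment> \<open>The two inverses need to agree only on the unit space of \<open>G2\<close>;
    \<open>homeomorphic_map_eq\<close> then transfers the homeomorphism property.\<close>
  have "inv_into (unit_space G1) \<phi> y = \<psi> y" if "y \<in> unit_space G2" for y
  proof (rule inv_into_f_eq[OF \<phi>_inj])
    show "\<psi> y \<in> unit_space G1" "\<phi> (\<psi> y) = y"
      using \<psi> that continuous_map_image_subset_topspace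
      unfolding homeomorphic_maps_def A.topspace_unit_top[symmetric] B.topspace_unit_top[symmetric] by blast+
  qed
  moreover have "homeomorphic_map (unit_top G2) (unit_top G1) \<psi>"
    using \<psi> homeomorphic_maps_sym homeomorphic_map_maps by blast
  ultimately show "homeomorphic_map (unit_top G2) (unit_top G1) (inv_into (unit_space G1) \<phi>)"
    by (metis B.topspace_unit_top homeomorphic_map_eq)
  fix \<beta> y assume \<beta>: "\<beta> \<in> \<Gamma>2" and y: "y \<in> unit_space G2"
  obtain \<alpha> where \<alpha>: "\<alpha> \<in> \<Gamma>1" "\<beta> = \<Phi> \<alpha>"
    using iso \<beta> by (auto simp: iso_def bij_betw_def)
  obtain x where x: "x \<in> unit_space G1" "y = \<phi> x" using y \<phi>_image by blast
  have "\<alpha> x \<in> unit_space G1" using A.full_group_closed[OF A.\<Gamma>_full[OF \<alpha>(1)] x(1)] .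
  moreover have "inv_into \<Gamma>1 \<Phi> \<beta> = \<alpha>"
    using iso \<alpha> by (auto simp: iso_def bij_betw_def)
  ultimately show "inv_into (unit_space G1) \<phi> (\<beta> y) = inv_into \<Gamma>1 \<Phi> \<beta> (inv_into (unit_space G1) \<phi> y)"
    using x \<alpha> equivariant[OF \<alpha>(1) x(1)] \<phi>_inj by (metis inv_into_f_f)
qed

text \<open>Inverting \<Phi> and \<phi> gives another instance of the locale, whose relation is the
  converse of \<open>rel\<close>; the two continuous arrow maps are therefore mutually
  inverse.\<close>

lemma etale_iso: "etale_groupoid_iso G1 G2"
proof -
  interpret inv: spatial_iso G2 \<Gamma>2 G1 \<Gamma>1 "inv_into \<Gamma>1 \<Phi>" "inv_into (unit_space G1) \<phi>"
    by (rule inverse_spatial_iso)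
  have inj: "inj_on \<Phi> \<Gamma>1" and surj: "\<Phi> ` \<Gamma>1 = \<Gamma>2"
    using iso by (auto simp: iso_def bij_betw_def)
  have rel_inv: "inv.rel h g" if "rel g h" for g h
  proof -
    obtain \<alpha> where \<alpha>: "\<alpha> \<in> \<Gamma>1" "A.germ \<alpha> g" "B.germ (\<Phi> \<alpha>) h" "src G2 h = \<phi> (src G1 g)"
      using \<open>rel g h\<close> unfolding rel_def by blast
    have "src G1 g = inv_into (unit_space G1) \<phi> (src G2 h)"
      using \<alpha>(4) \<phi>_inj A.src_unit[OF rel_arrows(1)[OF that]] by simp
    moreover have "inv_into \<Gamma>1 \<Phi> (\<Phi> \<alpha>) = \<alpha>" using inj \<alpha>(1) by simp
    ultimately show ?thesis
      unfolding inv.rel_def using \<alpha> by (intro bexI[OF _ \<Phi>_closed[OF \<alpha>(1)]]) simp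
  qed
  have rel_of_inv: "rel g h" if "inv.rel h g" for g h
  proof -
    obtain \<beta> where \<beta>: "\<beta> \<in> \<Gamma>2" "B.germ \<beta> h" "A.germ (inv_into \<Gamma>1 \<Phi> \<beta>) g"
      "src G1 g = inv_into (unit_space G1) \<phi> (src G2 h)"
      using \<open>inv.rel h g\<close> unfolding inv.rel_def by blast
    have "src G2 h \<in> \<phi> ` unit_space G1"
      using \<phi>_image B.src_unit[OF inv.rel_arrows(1)[OF that]] by simp
    then have "src G2 h = \<phi> (src G1 g)" using \<beta>(4) by (simp add: f_inv_into_f)
    moreover have "\<Phi> (inv_into \<Gamma>1 \<Phi> \<beta>) = \<beta>" using surj \<beta>(1) by (simp add: f_inv_into_f)
    ultimately show ?thesis
      unfolding rel_def using \<beta> by (intro bexI[OF _ inv.\<Phi>_closed[OF \<beta>(1)]]) simp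
  qed
  have inv1: "inv.arrow_map (arrow_map g) = g" if "g \<in> arrows G1" for g
    by (rule inv.arrow_map_eq[OF rel_inv[OF rel_arrow_map[OF that]]])
  have inv2: "arrow_map (inv.arrow_map h) = h" if "h \<in> arrows G2" for h
    by (rule arrow_map_eq[OF rel_of_inv[OF inv.rel_arrow_map[OF that]]])
  have maps: "homeomorphic_maps (gtop G1) (gtop G2) arrow_map inv.arrow_map"
    unfolding homeomorphic_maps_def A.topspace_gtop B.topspace_gtop
    using continuous_arrow_map inv.continuous_arrow_map inv1 inv2 by blast
  then have h: "homeomorphic_map (gtop G1) (gtop G2) arrow_map"
    using homeomorphic_map_maps by blast
  then have "bij_betw arrow_map (arrows G1) (arrows G2)"
    using homeomorphic_imp_injective_map homeomorphic_imp_surjective_map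
    unfolding bij_betw_def arrows_def by blast
  then show ?thesis
    unfolding etale_groupoid_iso_def using groupoid_hom_arrow_map h by blast
qed

end

theorem theorem3p9:
  fixes G1 :: "'a top_groupoid" and G2 :: "'b top_groupoid"
    and \<Gamma>1 :: "('a \<Rightarrow> 'a) set" and \<Gamma>2 :: "('b \<Rightarrow> 'b) set"
  assumes "etale_groupoid G1" and "etale_groupoid G2"
    and "essentially_principal G1" and "essentially_principal G2"
    and "cantor_set (unit_top G1)" and "cantor_set (unit_top G2)"
    and "minimal_groupoid G1" and "minimal_groupoid G2"
    and "subgroup \<Gamma>1 (topological_full_group G1)"
    and "subgroup \<Gamma>2 (topological_full_group G2)"
    and "commutator_subgroup (topological_full_group G1) \<subseteq> \<Gamma>1"
    and "commutator_subgroup (topological_full_group G2) \<subseteq> \<Gamma>2"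
    and "(topological_full_group G1)\<lparr>carrier := \<Gamma>1\<rparr> \<cong> (topological_full_group G2)\<lparr>carrier := \<Gamma>2\<rparr>"
  shows "etale_groupoid_iso G1 G2"
proof -
  interpret A: full_subgroup G1 \<Gamma>1
    using assms by (intro full_subgroup.intro minimal_cantor_groupoid.intro
        minimal_cantor_groupoid_axioms.intro full_subgroup_axioms.intro)
  interpret B: full_subgroup G2 \<Gamma>2
    using assms by (intro full_subgroup.intro minimal_cantor_groupoid.intro
        minimal_cantor_groupoid_axioms.intro full_subgroup_axioms.intro)
  obtain \<Phi> where \<Phi>: "\<Phi> \<in> iso A.H B.H"
    using assms(13) unfolding is_iso_def by blast
  interpret rubin_pair A.H "unit_top G1" B.H "unit_top G2" \<Phi>
    using A.rubin_action B.rubin_action \<Phi> by (intro rubin_pair.intro rubin_pair_axioms.intro)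
  interpret spatial_iso G1 \<Gamma>1 G2 \<Gamma>2 \<Phi> point_map
  proof unfold_locales
    show "\<Phi> \<in> iso A.H B.H" by (rule \<Phi>)
    show "homeomorphic_map (unit_top G1) (unit_top G2) point_map"
      by (rule homeomorphic_point_map)
    show "point_map (\<alpha> x) = \<Phi> \<alpha> (point_map x)" if "\<alpha> \<in> \<Gamma>1" "x \<in> unit_space G1" for \<alpha> x
      using point_map_equivariant that by (simp add: A.topspace_unit_top)
  qed
  show ?thesis by (rule etale_iso)
qed

end
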